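(* The family $\{(\mathbf{H}_\phi,\mathbf{cNOT}_\phi):\phi\in[0,2\pi)\}$ is characterized by the following experimental equations in two variables; i.e. a pair $(\mathbf{F},\mathbf{G})$, with $\mathbf{F}$ a one-qubit CPSO and $\mathbf{G}$ a two-qubit CPSO, belongs to this family if and only if it satisfies all of: $\mathrm{Pr}^0[\mathbf{F}(|0\rangle\langle0|)]=\tfrac12$, $\mathrm{Pr}^0[\mathbf{F}^2(|0\rangle\langle0|)]=1$, $\mathrm{Pr}^0[\mathbf{F}^2(|1\rangle\langle1|)]=0$, $\mathrm{Pr}^{00}[\mathbf{G}(|00\rangle\langle00|)]=1$, $\mathrm{Pr}^{01}[\mathbf{G}(|01\rangle\langle01|)]=1$, $\mathrm{Pr}^{11}[\mathbf{G}(|10\rangle\langle10|)]=1$, $\mathrm{Pr}^{10}[\mathbf{G}(|11\rangle\langle11|)]=1$, $\mathrm{Pr}^{00}[(\mathbf{I}_2\otimes\mathbf{F})\circ\mathbf{G}\circ(\mathbf{I}_2\otimes\mathbf{F})(|00\rangle\langle00|)]=1$, $\mathrm{Pr}^{10}[(\mathbf{I}_2\otimes\mathbf{F})\circ\mathbf{G}\circ(\mathbf{I}_2\otimes\mathbf{F})(|10\rangle\langle10|)]=1$, $\mathrm{Pr}^{00}[(\mathbf{F}\otimes\mathbf{I}_2)\circ\mathbf{G}^2\circ(\mathbf{F}\otimes\mathbf{I}_2)(|00\rangle\langle00|)]=1$, $\mathrm{Pr}^{01}[(\mathbf{F}\otimes\mathbf{I}_2)\circ\mathbf{G}^2\circ(\mathbf{F}\otimes\mathbf{I}_2)(|01\rangle\langle01|)]=1$,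 $\mathrm{Pr}^{00}[(\mathbf{F}\otimes\mathbf{F})\circ\mathbf{G}\circ(\mathbf{F}\otimes\mathbf{F})(|00\rangle\langle00|)]=1$.
   Context: An $n$-qubit density matrix is a positive semidefinite Hermitian $N\times N$ matrix of trace $1$, $N=2^n$, with rows and columns indexed by $\{0,1\}^n$. An $n$-qubit superoperator is a linear map on $\mathbb{C}^{N\times N}$; a superoperator is a PSO if it sends density matrices to density matrices; $\mathbf{G}$ is a CPSO if $\mathbf{G}\otimes\mathbf{I}_M$ is a PSO for every positive integer $M$, where $\mathbf{I}_M$ is the identity on $\mathbb{C}^{M\times M}$. For $v\in\{0,1\}^n$, $\mathrm{Pr}^v[\rho]=\langle v|\rho|v\rangle$. For a unitary $A$, $\mathbf{A}$ denotes the CPSO $\rho\mapsto A\rho A^\dagger$. For $\phi\in[0,2\pi)$: $H_\phi$ is the unitary on $\mathbb{C}^2$ with $H_\phi|0\rangle=(|0\rangle+e^{i\phi}|1\rangle)/\sqrt2$ and $H_\phi(e^{i\phi}|1\rangle)=(|0\rangle-e^{i\phi}|1\rangle)/\sqrt2$; $\mathrm{NOT}_\phi$ is the unitary with $\mathrm{NOT}_\phi|0\rangle=e^{i\phi}|1\rangle$ and $\mathrm{NOT}_\phi(e^{i\phi}|1\rangle)=|0\rangle$; $\mathrm{cNOT}_\phi$ is the unitary on $\mathbb{C}^4=\mathbb{C}^2\otimes\mathbb{C}^2$ with $\mathrm{cNOT}_\phi|0\rangle|\psi\rangle=|0\rangle|\psi\rangle$ and $\mathrm{cNOT}_\phi|1\rangle|\psi\rangle=|1\rangle\mathrm{NOT}_\phi|\psi\rangle$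 for all $|\psi\rangle\in\mathbb{C}^2$. *)

theory Defs
  imports Complex_Main "Jordan_Normal_Form.Schur_Decomposition"
begin

section \<open>Tensor products and basis states\<close>

text \<open>Big-endian convention: the index of a tensor product basis element \<open>(i, k)\<close> is
  \<open>i * n + k\<close>, where \<open>n\<close> is the dimension of the second factor.\<close>

definition tensor_vec :: "complex vec \<Rightarrow> complex vec \<Rightarrow> complex vec" where
  "tensor_vec u v = vec (dim_vec u * dim_vec v)
     (\<lambda>i. u $ (i div dim_vec v) * v $ (i mod dim_vec v))"

definition tensor_mat :: "complex mat \<Rightarrow> complex mat \<Rightarrow> complex mat" where
  "tensor_mat A B = mat (dim_row A * dim_row B) (dim_col A * dim_col B)
     (\<lambda>(i, j). A $$ (i div dim_row B, j div dim_col B) * B $$ (i mod dim_row B, j mod dim_col B))"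

text \<open>Bit strings are lists over \<open>{0, 1}\<close>.\<close>

fun ket :: "nat list \<Rightarrow> complex vec" where
  "ket [] = unit_vec 1 0"
| "ket (b # bs) = tensor_vec (unit_vec 2 b) (ket bs)"

definition proj :: "complex vec \<Rightarrow> complex mat" where
  "proj v = mat (dim_vec v) (dim_vec v) (\<lambda>(i, j). v $ i * cnj (v $ j))"

definition Pr :: "nat list \<Rightarrow> complex mat \<Rightarrow> complex" where
  "Pr w \<rho> = (\<rho> *\<^sub>v ket w) \<bullet>c ket w"


section \<open>Density matrices and superoperators\<close>

text \<open>The order on \<^typ>\<open>complex\<close> is the one where \<open>0 \<le> z\<close> means that \<open>z\<close> is a nonnegative real.\<close>

definition density_matrix :: "nat \<Rightarrow> complex mat \<Rightarrow> bool" where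
  "density_matrix d \<rho> \<longleftrightarrow> \<rho> \<in> carrier_mat d d \<and> mat_adjoint \<rho> = \<rho> \<and>
     (\<forall>v \<in> carrier_vec d. 0 \<le> (\<rho> *\<^sub>v v) \<bullet>c v) \<and> (\<Sum>i<d. \<rho> $$ (i, i)) = 1"

definition superoperator :: "nat \<Rightarrow> (complex mat \<Rightarrow> complex mat) \<Rightarrow> bool" where
  "superoperator d F \<longleftrightarrow> F \<in> carrier_mat d d \<rightarrow> carrier_mat d d \<and>
     (\<forall>A \<in> carrier_mat d d. \<forall>B \<in> carrier_mat d d. F (A + B) = F A + F B) \<and>
     (\<forall>c. \<forall>A \<in> carrier_mat d d. F (c \<cdot>\<^sub>m A) = c \<cdot>\<^sub>m F A)"

text \<open>A superoperator on dimension \<open>d\<close> is represented by a HOL function whose values outside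
  \<open>carrier_mat d d\<close> are irrelevant, so equality of superoperators is agreement on the carrier.\<close>

definition superop_eq ::
  "nat \<Rightarrow> (complex mat \<Rightarrow> complex mat) \<Rightarrow> (complex mat \<Rightarrow> complex mat) \<Rightarrow> bool" where
  "superop_eq d F G \<longleftrightarrow> (\<forall>\<rho> \<in> carrier_mat d d. F \<rho> = G \<rho>)"

definition matrix_unit :: "nat \<Rightarrow> nat \<Rightarrow> nat \<Rightarrow> complex mat" where
  "matrix_unit d i j = mat d d (\<lambda>(a, b). if a = i \<and> b = j then 1 else 0)"

text \<open>The linear extension of \<open>A \<otimes> B \<mapsto> F A \<otimes> G B\<close>, written out on the basis of tensor products of
  matrix units; lemmas \<open>superoperator_tensor\<close> and \<open>tensor_superop_tensor_mat\<close> below state that it is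
  linear and satisfies this equation for all \<open>A\<close> and \<open>B\<close>.\<close>

definition tensor_superop :: "nat \<Rightarrow> nat \<Rightarrow> (complex mat \<Rightarrow> complex mat) \<Rightarrow>
    (complex mat \<Rightarrow> complex mat) \<Rightarrow> complex mat \<Rightarrow> complex mat" where
  "tensor_superop m n F G X = mat (m * n) (m * n) (\<lambda>(a, b).
     \<Sum>i<m. \<Sum>j<m. \<Sum>k<n. \<Sum>l<n. X $$ (i * n + k, j * n + l) *
       tensor_mat (F (matrix_unit m i j)) (G (matrix_unit n k l)) $$ (a, b))"

definition PSO :: "nat \<Rightarrow> (complex mat \<Rightarrow> complex mat) \<Rightarrow> bool" where
  "PSO d F \<longleftrightarrow> superoperator d F \<and> (\<forall>\<rho>. density_matrix d \<rho> \<longrightarrow> density_matrix d (F \<rho>))"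

definition CPSO :: "nat \<Rightarrow> (complex mat \<Rightarrow> complex mat) \<Rightarrow> bool" where
  "CPSO d F \<longleftrightarrow> superoperator d F \<and> (\<forall>M>0. PSO (d * M) (tensor_superop d M F id))"

definition unitary_superop :: "complex mat \<Rightarrow> complex mat \<Rightarrow> complex mat" where
  "unitary_superop A \<rho> = A * \<rho> * mat_adjoint A"


section \<open>The gates\<close>

text \<open>The entries come from solving the defining equations on basis vectors; see \<open>H_gate_iff\<close>,
  \<open>NOT_gate_iff\<close> and \<open>cNOT_gate_tensor\<close> below.\<close>

definition H_gate :: "real \<Rightarrow> complex mat" where
  "H_gate \<phi> = mat_of_rows_list 2
     [[1 / sqrt 2, cis (-\<phi>) / sqrt 2],
      [cis \<phi> / sqrt 2, -1 / sqrt 2]]"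

definition NOT_gate :: "real \<Rightarrow> complex mat" where
  "NOT_gate \<phi> = mat_of_rows_list 2
     [[0, cis (-\<phi>)],
      [cis \<phi>, 0]]"

definition cNOT_gate :: "real \<Rightarrow> complex mat" where
  "cNOT_gate \<phi> = four_block_mat (1\<^sub>m 2) (0\<^sub>m 2 2) (0\<^sub>m 2 2) (NOT_gate \<phi>)"


section \<open>Sanity checks\<close>

lemma ket_1: "ket [b] = unit_vec 2 b"
  by (rule eq_vecI) (auto simp: tensor_vec_def unit_vec_def)

lemma less_4_cases_iff: "i < (4::nat) \<longleftrightarrow> i = 0 \<or> i = 1 \<or> i = 2 \<or> i = 3"
  by auto

lemma ket_2:
  "ket [0, 0] = unit_vec 4 0" "ket [0, 1] = unit_vec 4 1"
  "ket [1, 0] = unit_vec 4 2" "ket [1, 1] = unit_vec 4 3"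
proof -
  have k: "ket [a, b] = vec 4 (\<lambda>i. unit_vec 2 a $ (i div 2) * unit_vec 2 b $ (i mod 2))" for a b
    using ket.simps(2)[of a "[b]"] unfolding ket_1 by (simp add: tensor_vec_def)
  have e: "vec 4 f = unit_vec 4 j \<longleftrightarrow>
      f 0 = of_bool (j = 0) \<and> f 1 = of_bool (j = 1) \<and> f 2 = of_bool (j = 2) \<and> f 3 = of_bool (j = 3)"
    for f :: "nat \<Rightarrow> complex" and j
    by (auto simp: vec_eq_iff less_4_cases_iff unit_vec_def all_conj_distrib)
  show "ket [0, 0] = unit_vec 4 0" "ket [0, 1] = unit_vec 4 1"
    "ket [1, 0] = unit_vec 4 2" "ket [1, 1] = unit_vec 4 3"
    unfolding k e by simp_all
qed

lemma mult_vec_2: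
  assumes "A \<in> carrier_mat 2 2" "v \<in> carrier_vec 2"
  shows "A *\<^sub>v v = vec 2 (\<lambda>i. A $$ (i, 0) * v $ 0 + A $$ (i, 1) * v $ 1)"
proof -
  have "{0..<2} = {0, 1::nat}" by auto
  then show ?thesis using assms by (intro eq_vecI) (simp_all add: scalar_prod_def)
qed

lemma gate_carrier [simp]:
  "H_gate \<phi> \<in> carrier_mat 2 2" "NOT_gate \<phi> \<in> carrier_mat 2 2" "cNOT_gate \<phi> \<in> carrier_mat 4 4"
proof -
  show N: "NOT_gate \<phi> \<in> carrier_mat 2 2"
    unfolding NOT_gate_def mat_of_rows_list_def by (rule carrier_matI) simp_all
  show "H_gate \<phi> \<in> carrier_mat 2 2"
    unfolding H_gate_def mat_of_rows_list_def by (rule carrier_matI) simp_all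
  have "cNOT_gate \<phi> \<in> carrier_mat (2 + 2) (2 + 2)"
    unfolding cNOT_gate_def by (rule four_block_carrier_mat[OF one_carrier_mat N])
  then show "cNOT_gate \<phi> \<in> carrier_mat 4 4" by simp
qed

lemma mat_2_eqI:
  assumes "A \<in> carrier_mat 2 2" "B \<in> carrier_mat 2 2"
    "A $$ (0, 0) = B $$ (0, 0)" "A $$ (0, 1) = B $$ (0, 1)"
    "A $$ (1, 0) = B $$ (1, 0)" "A $$ (1, 1) = B $$ (1, 1)"
  shows "A = B"
  using assms by (intro eq_matI) (auto simp: less_2_cases_iff)

lemma vec_2_eq_iff: "vec 2 f = vec 2 g \<longleftrightarrow> f 0 = g 0 \<and> f 1 = g 1"
  by (auto simp: vec_eq_iff less_2_cases_iff)

lemma cis_shift: "cis \<phi> * z = w \<longleftrightarrow> z = cis (-\<phi>) * w"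
proof -
  have "cis \<phi> * cis (-\<phi>) = 1" by (simp add: cis_mult)
  then show ?thesis by (metis mult.assoc mult.commute mult_1)
qed

lemma H_gate_iff:
  assumes A: "A \<in> carrier_mat 2 2"
  shows "A = H_gate \<phi> \<longleftrightarrow>
    A *\<^sub>v ket [0] = complex_of_real (1 / sqrt 2) \<cdot>\<^sub>v (ket [0] + cis \<phi> \<cdot>\<^sub>v ket [1]) \<and>
    A *\<^sub>v (cis \<phi> \<cdot>\<^sub>v ket [1]) = complex_of_real (1 / sqrt 2) \<cdot>\<^sub>v (ket [0] - cis \<phi> \<cdot>\<^sub>v ket [1])"
    (is "_ \<longleftrightarrow> ?P")
proof -
  let ?s = "complex_of_real (1 / sqrt 2)"
  have r: "?s \<cdot>\<^sub>v (ket [0] + cis \<phi> \<cdot>\<^sub>v ket [1]) = vec 2 (\<lambda>i. if i = 0 then ?s else ?s * cis \<phi>)"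
    "?s \<cdot>\<^sub>v (ket [0] - cis \<phi> \<cdot>\<^sub>v ket [1]) = vec 2 (\<lambda>i. if i = 0 then ?s else - (?s * cis \<phi>))"
    unfolding ket_1 by (rule eq_vecI; force simp: less_2_cases_iff)+
  have l: "A *\<^sub>v ket [0] = vec 2 (\<lambda>i. A $$ (i, 0))"
    "A *\<^sub>v (cis \<phi> \<cdot>\<^sub>v ket [1]) = vec 2 (\<lambda>i. cis \<phi> * A $$ (i, 1))"
    unfolding ket_1 by (subst mult_vec_2[OF A]; auto simp: vec_2_eq_iff)+
  have "?P \<longleftrightarrow> A $$ (0, 0) = ?s \<and> A $$ (1, 0) = ?s * cis \<phi> \<and>
      A $$ (0, 1) = cis (-\<phi>) * ?s \<and> A $$ (1, 1) = - ?s"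
  proof -
    have e: "cis (-\<phi>) * cis \<phi> = 1" by (simp add: cis_mult)
    show ?thesis unfolding l r vec_2_eq_iff cis_shift by (simp add: e)
  qed
  also have "\<dots> \<longleftrightarrow> A = H_gate \<phi>"
  proof -
    have H: "H_gate \<phi> $$ (0, 0) = ?s" "H_gate \<phi> $$ (1, 0) = ?s * cis \<phi>"
      "H_gate \<phi> $$ (0, 1) = cis (-\<phi>) * ?s" "H_gate \<phi> $$ (1, 1) = - ?s"
      by (simp_all add: H_gate_def mat_of_rows_list_def)
    show ?thesis using H mat_2_eqI[OF A gate_carrier(1)[of \<phi>]] by metis
  qed
  finally show ?thesis by blast
qed

lemma NOT_gate_iff:
  assumes A: "A \<in> carrier_mat 2 2"
  shows "A = NOT_gate \<phi> \<longleftrightarrow>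
    A *\<^sub>v ket [0] = cis \<phi> \<cdot>\<^sub>v ket [1] \<and> A *\<^sub>v (cis \<phi> \<cdot>\<^sub>v ket [1]) = ket [0]"
    (is "_ \<longleftrightarrow> ?P")
proof -
  have r: "cis \<phi> \<cdot>\<^sub>v ket [1] = vec 2 (\<lambda>i. if i = 0 then 0 else cis \<phi>)"
    "ket [0] = vec 2 (\<lambda>i. if i = 0 then 1 else 0)"
    unfolding ket_1 by (rule eq_vecI; force simp: less_2_cases_iff)+
  have l: "A *\<^sub>v ket [0] = vec 2 (\<lambda>i. A $$ (i, 0))"
    "A *\<^sub>v (cis \<phi> \<cdot>\<^sub>v ket [1]) = vec 2 (\<lambda>i. cis \<phi> * A $$ (i, 1))"
    unfolding ket_1 by (subst mult_vec_2[OF A]; auto simp: vec_2_eq_iff)+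
  have "?P \<longleftrightarrow> A $$ (0, 0) = 0 \<and> A $$ (1, 0) = cis \<phi> \<and>
      A $$ (0, 1) = cis (-\<phi>) \<and> A $$ (1, 1) = 0"
    unfolding l unfolding r vec_2_eq_iff cis_shift by auto
  also have "\<dots> \<longleftrightarrow> A = NOT_gate \<phi>"
  proof -
    have H: "NOT_gate \<phi> $$ (0, 0) = 0" "NOT_gate \<phi> $$ (1, 0) = cis \<phi>"
      "NOT_gate \<phi> $$ (0, 1) = cis (-\<phi>)" "NOT_gate \<phi> $$ (1, 1) = 0"
      by (simp_all add: NOT_gate_def mat_of_rows_list_def)
    show ?thesis using H mat_2_eqI[OF A gate_carrier(2)[of \<phi>]] by metis
  qed
  finally show ?thesis by blast
qed

lemma cNOT_gate_tensor:
  assumes \<psi>: "\<psi> \<in> carrier_vec 2"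
  shows "cNOT_gate \<phi> *\<^sub>v tensor_vec (ket [0]) \<psi> = tensor_vec (ket [0]) \<psi>"
    "cNOT_gate \<phi> *\<^sub>v tensor_vec (ket [1]) \<psi> = tensor_vec (ket [1]) (NOT_gate \<phi> *\<^sub>v \<psi>)"
proof -
  have t: "tensor_vec (ket [0]) v = v @\<^sub>v 0\<^sub>v 2" "tensor_vec (ket [1]) v = 0\<^sub>v 2 @\<^sub>v v"
    if "v \<in> carrier_vec 2" for v
    using that unfolding ket_1 vec_eq_iff
    by (auto simp: tensor_vec_def append_vec_def less_4_cases_iff Let_def)
  have m: "cNOT_gate \<phi> *\<^sub>v (u @\<^sub>v v) = u @\<^sub>v (NOT_gate \<phi> *\<^sub>v v)"
    if uv: "u \<in> carrier_vec 2" "v \<in> carrier_vec 2" for u v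
  proof -
    have N: "NOT_gate \<phi> *\<^sub>v v \<in> carrier_vec 2"
      by (rule mult_mat_vec_carrier[OF gate_carrier(2) uv(2)])
    have z: "0\<^sub>m 2 2 *\<^sub>v w = 0\<^sub>v 2" if "w \<in> carrier_vec 2" for w :: "complex vec"
      using that by (intro eq_vecI) (auto simp: scalar_prod_def)
    show ?thesis
      unfolding cNOT_gate_def using uv N
      by (subst four_block_mat_mult_vec[of _ 2 2 _ 2 _ 2]) (auto simp: z)
  qed
  have N: "NOT_gate \<phi> *\<^sub>v \<psi> \<in> carrier_vec 2"
    by (rule mult_mat_vec_carrier[OF gate_carrier(2) \<psi>])
  have N0: "NOT_gate \<phi> *\<^sub>v 0\<^sub>v 2 = 0\<^sub>v 2"
    by (subst mult_vec_2) (auto intro!: eq_vecI)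
  show "cNOT_gate \<phi> *\<^sub>v tensor_vec (ket [0]) \<psi> = tensor_vec (ket [0]) \<psi>"
    "cNOT_gate \<phi> *\<^sub>v tensor_vec (ket [1]) \<psi> = tensor_vec (ket [1]) (NOT_gate \<phi> *\<^sub>v \<psi>)"
    unfolding t[OF \<psi>] t[OF N] using \<psi> by (simp_all add: m N0)
qed

lemma superoperator_expand:
  assumes F: "superoperator d F" and A: "A \<in> carrier_mat d d" and ab: "a < d" "b < d"
  shows "F A $$ (a, b) = (\<Sum>i<d. \<Sum>j<d. A $$ (i, j) * F (matrix_unit d i j) $$ (a, b))"
proof -
  define R where "R S = mat d d (\<lambda>p. if p \<in> S then A $$ p else 0)" for S
  have E: "F (matrix_unit d i j) \<in> carrier_mat d d" for i j
    using F unfolding superoperator_def by (auto simp: matrix_unit_def Pi_iff)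
  have R: "R S \<in> carrier_mat d d" for S by (simp add: R_def)
  have FR: "F (R S) \<in> carrier_mat d d" for S
    using F R unfolding superoperator_def by (auto simp: Pi_iff)
  have U: "matrix_unit d i j \<in> carrier_mat d d" for i j by (simp add: matrix_unit_def)
  have "F (R S) $$ (a, b) = (\<Sum>(i, j) \<in> S. A $$ (i, j) * F (matrix_unit d i j) $$ (a, b))"
    if "finite S" "S \<subseteq> {..<d} \<times> {..<d}" for S
    using that
  proof (induction S rule: finite_induct)
    case empty
    have "R {} = 0 \<cdot>\<^sub>m R {}" by (intro eq_matI) (auto simp: R_def)
    then have "F (R {}) = 0 \<cdot>\<^sub>m F (R {})"
      using F R unfolding superoperator_def by metis
    then have "F (R {}) $$ (a, b) = (0 \<cdot>\<^sub>m F (R {})) $$ (a, b)" by simp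
    also have "\<dots> = 0" using FR[of "{}"] ab by auto
    finally show ?case by simp
  next
    case (insert p S)
    obtain i j where p: "p = (i, j)" by (cases p)
    have "R (insert p S) = A $$ (i, j) \<cdot>\<^sub>m matrix_unit d i j + R S"
      using insert by (intro eq_matI) (auto simp: R_def matrix_unit_def p)
    then have "F (R (insert p S)) = A $$ (i, j) \<cdot>\<^sub>m F (matrix_unit d i j) + F (R S)"
      using F R U unfolding superoperator_def by (metis smult_carrier_mat)
    then show ?case using insert ab E[of i j] FR[of S] by (auto simp: p)
  qed
  from this[of "{..<d} \<times> {..<d}"]
  have "F (R ({..<d} \<times> {..<d})) $$ (a, b) =
      (\<Sum>i<d. \<Sum>j<d. A $$ (i, j) * F (matrix_unit d i j) $$ (a, b))"
    by (simp add: sum.cartesian_product)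
  moreover have "R ({..<d} \<times> {..<d}) = A" using A by (intro eq_matI) (auto simp: R_def)
  ultimately show ?thesis by simp
qed

lemma idx_bound: "i < m \<Longrightarrow> k < n \<Longrightarrow> i * n + k < m * (n::nat)"
proof -
  assume "i < m" "k < n"
  then have "i * n + k < Suc i * n" by simp
  also have "\<dots> \<le> m * n" using \<open>i < m\<close> by (intro mult_le_mono1) simp
  finally show ?thesis .
qed

lemma superoperator_tensor:
  "superoperator (m * n) (tensor_superop m n F G)"
proof -
  have i: "i < m \<Longrightarrow> k < n \<Longrightarrow> i * n + k < m * n" for i k
    by (rule idx_bound)
  have add: "tensor_superop m n F G (A + B) = tensor_superop m n F G A + tensor_superop m n F G B"
    if AB: "A \<in> carrier_mat (m * n) (m * n)" "B \<in> carrier_mat (m * n) (m * n)" for A B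
  proof -
    have "(A + B) $$ (i * n + k, j * n + l) = A $$ (i * n + k, j * n + l) + B $$ (i * n + k, j * n + l)"
      if "i < m" "j < m" "k < n" "l < n" for i j k l
      using that i[of i k] i[of j l] AB by auto
    then show ?thesis
      by (intro eq_matI) (simp_all add: tensor_superop_def distrib_right sum.distrib)
  qed
  have smult: "tensor_superop m n F G (c \<cdot>\<^sub>m A) = c \<cdot>\<^sub>m tensor_superop m n F G A"
    if A: "A \<in> carrier_mat (m * n) (m * n)" for c A
  proof -
    have "(c \<cdot>\<^sub>m A) $$ (i * n + k, j * n + l) = c * A $$ (i * n + k, j * n + l)"
      if "i < m" "j < m" "k < n" "l < n" for i j k l
      using that i[of i k] i[of j l] A by auto
    then show ?thesis
      by (intro eq_matI) (simp_all add: tensor_superop_def sum_distrib_left mult.assoc)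
  qed
  show ?thesis
    using add smult by (simp add: superoperator_def tensor_superop_def)
qed

lemma tensor_superop_tensor_mat:
  assumes F: "superoperator m F" and G: "superoperator n G"
    and A: "A \<in> carrier_mat m m" and B: "B \<in> carrier_mat n n"
  shows "tensor_superop m n F G (tensor_mat A B) = tensor_mat (F A) (G B)"
proof -
  have FA: "F X \<in> carrier_mat m m" if "X \<in> carrier_mat m m" for X
    using F that unfolding superoperator_def by auto
  have GB: "G X \<in> carrier_mat n n" if "X \<in> carrier_mat n n" for X
    using G that unfolding superoperator_def by auto
  have U: "matrix_unit d i j \<in> carrier_mat d d" for d i j by (simp add: matrix_unit_def)
  have T: "tensor_mat X Y $$ (a, b) = X $$ (a div n, b div n) * Y $$ (a mod n, b mod n)"
    if "X \<in> carrier_mat m m" "Y \<in> carrier_mat n n" "a < m * n" "b < m * n" for X Y a b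
    using that by (auto simp: tensor_mat_def)
  show ?thesis
  proof (rule eq_matI)
    fix a b
    assume "a < dim_row (tensor_mat (F A) (G B))" "b < dim_col (tensor_mat (F A) (G B))"
    then have ab: "a < m * n" "b < m * n"
      using FA[OF A] GB[OF B] by (auto simp: tensor_mat_def)
    then have n: "n > 0" by (cases n) auto
    have ab': "a div n < m" "b div n < m" "a mod n < n" "b mod n < n"
      using ab n by (auto simp: less_mult_imp_div_less)
    have "tensor_superop m n F G (tensor_mat A B) $$ (a, b) =
      (\<Sum>i<m. \<Sum>j<m. \<Sum>k<n. \<Sum>l<n. (A $$ (i, j) * F (matrix_unit m i j) $$ (a div n, b div n)) *
         (B $$ (k, l) * G (matrix_unit n k l) $$ (a mod n, b mod n)))"
      unfolding tensor_superop_def using ab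
      by (auto simp: T[OF FA[OF U] GB[OF U]] T[OF A B] idx_bound intro!: sum.cong)
    also have "\<dots> = F A $$ (a div n, b div n) * G B $$ (a mod n, b mod n)"
      unfolding superoperator_expand[OF F A ab'(1,2)] superoperator_expand[OF G B ab'(3,4)]
      unfolding sum_distrib_right unfolding sum_distrib_left ..
    also have "\<dots> = tensor_mat (F A) (G B) $$ (a, b)"
      using T[OF FA[OF A] GB[OF B] ab] by simp
    finally show "tensor_superop m n F G (tensor_mat A B) $$ (a, b) =
      tensor_mat (F A) (G B) $$ (a, b)" .
  qed (use FA[OF A] GB[OF B] in \<open>auto simp: tensor_superop_def tensor_mat_def\<close>)
qed

end

theory Submission
  imports Defs
begin

text \<open>Complete positivity enters through the Choi matrix, whose positivity gives a Cauchy--Schwarz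
  inequality \<open>|\<langle>x|F(|k\<rangle>\<langle>l|)|y\<rangle>|\<^sup>2 \<le> \<langle>x|F(|k\<rangle>\<langle>k|)|x\<rangle> \<langle>y|F(|l\<rangle>\<langle>l|)|y\<rangle>\<close>: once \<open>F\<close> sends the diagonal
  matrix units to rank-one projections, each off-diagonal one is known up to a factor in the unit disc.

  For \<open>F\<close>, the equations say that \<open>F\<close> sends \<open>F(|0\<rangle>\<langle>0|)\<close> and \<open>F(|1\<rangle>\<langle>1|)\<close> to the two poles of the Bloch ball.
  As \<open>F\<close> does not increase distances, these two states are antipodal, hence pure, and on the equator;
  the remaining factor is found by applying \<open>F\<close> to their difference. For \<open>G\<close>, the four equations on
  basis states make \<open>G\<close> a permutation of the diagonal units with sixteen unknown factors in the unit
  disc, and the last equation says that these factors, after a rotation by known phases, sum to \<open>16\<close>.\<close>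

section \<open>Positive semidefinite forms and density matrices\<close>

lemma sum_lessThan_2: "(\<Sum>i<2. f i) = f 0 + f (1::nat)"
  by (simp add: numeral_2_eq_2)

lemma sum_lessThan_4: "(\<Sum>i<4. f i) = f 0 + f 1 + f 2 + f (3::nat)"
  by (simp add: eval_nat_numeral)

lemma sum_div_mod:
  "(\<Sum>r<m * n. f (r div n) (r mod n)) = (\<Sum>i<m. \<Sum>k<(n::nat). f i k)"
proof -
  have "(\<Sum>r<m * n. f (r div n) (r mod n)) = (\<Sum>i<m. \<Sum>r = i * n..<i * n + n. f (r div n) (r mod n))"
    by (rule sum.nat_group[symmetric])
  also have "\<dots> = (\<Sum>i<m. \<Sum>k<n. f i k)"
  proof (rule sum.cong[OF refl])
    fix i
    have "(\<Sum>r = i * n..<i * n + n. f (r div n) (r mod n)) = (\<Sum>k = 0..<n. f ((k + i * n) div n) ((k + i * n) mod n))"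
      using sum.shift_bounds_nat_ivl[of "\<lambda>r. f (r div n) (r mod n)" 0 "i * n" n] by (simp add: add.commute)
    then show "(\<Sum>r = i * n..<i * n + n. f (r div n) (r mod n)) = (\<Sum>k<n. f i k)"
      by (simp add: atLeast0LessThan)
  qed
  finally show ?thesis .
qed

lemma sum_delta_2:
  fixes g :: "nat \<Rightarrow> nat \<Rightarrow> 'a::comm_monoid_add"
  assumes "p < m" "q < n"
  shows "(\<Sum>k<m. \<Sum>l<n. if k = p then if l = q then g k l else 0 else 0) = g p q"
proof -
  have "(\<Sum>k<m. \<Sum>l<n. if k = p then if l = q then g k l else 0 else 0) =
      (\<Sum>k<m. if k = p then \<Sum>l<n. if l = q then g k l else 0 else 0)"
    by (intro sum.cong refl) simp
  then show ?thesis using assms by simp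
qed

text \<open>The sesquilinear form of \<open>R\<close>, conjugate-linear in the first argument.
  Vectors are plain functions, of which only the values below \<open>d\<close> matter, so no carrier
  conditions arise.\<close>

definition sesq :: "nat \<Rightarrow> complex mat \<Rightarrow> (nat \<Rightarrow> complex) \<Rightarrow> (nat \<Rightarrow> complex) \<Rightarrow> complex" where
  "sesq d R x y = (\<Sum>a<d. \<Sum>b<d. cnj (x a) * R $$ (a, b) * y b)"

section \<open>Density matrices through their entries and forms\<close>

lemma mult_vec_cscalar_prod:
  assumes "R \<in> carrier_mat d d" "v \<in> carrier_vec d" "w \<in> carrier_vec d"
  shows "(R *\<^sub>v v) \<bullet>c w = sesq d R (($) w) (($) v)"
  using assms
  by (auto simp: sesq_def scalar_prod_def atLeast0LessThan sum_distrib_left sum_distrib_right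
      mult_ac intro!: sum.cong)

lemma sesq_vec: "sesq d R (($) (vec d x)) (($) (vec d y)) = sesq d R x y"
  by (simp add: sesq_def)

lemma mat_adjoint_index:
  assumes "A \<in> carrier_mat n m" "i < m" "j < n"
  shows "mat_adjoint A $$ (i, j) = cnj (A $$ (j, i))"
  using assms by (auto simp: mat_adjoint_def mat_of_rows_def)

lemma mat_adjoint_dim [simp]:
  "dim_row (mat_adjoint A) = dim_col A" "dim_col (mat_adjoint A) = dim_row A"
  by (simp_all add: mat_adjoint_def)

lemma density_matrix_entries:
  assumes "R \<in> carrier_mat d d"
    and "\<And>a b. a < d \<Longrightarrow> b < d \<Longrightarrow> R $$ (a, b) = cnj (R $$ (b, a))"
    and "\<And>x. 0 \<le> sesq d R x x"
    and "(\<Sum>i<d. R $$ (i, i)) = 1"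
  shows "density_matrix d R"
  unfolding density_matrix_def
proof (intro conjI ballI)
  show "mat_adjoint R = R"
  proof (rule eq_matI)
    fix i j assume "i < dim_row R" "j < dim_col R"
    then have "i < d" "j < d" using assms(1) by auto
    then show "mat_adjoint R $$ (i, j) = R $$ (i, j)"
      using mat_adjoint_index[OF assms(1)] assms(2) by metis
  qed (use assms(1) in auto)
  show "0 \<le> (R *\<^sub>v v) \<bullet>c v" if "v \<in> carrier_vec d" for v
    using mult_vec_cscalar_prod[OF assms(1) that that] assms(3) by simp
qed (use assms(1,4) in auto)

lemma density_matrix_cnj:
  assumes "density_matrix d R" "a < d" "b < d"
  shows "R $$ (a, b) = cnj (R $$ (b, a))"
proof -
  have "mat_adjoint R = R" and R: "R \<in> carrier_mat d d" using assms(1) by (auto simp: density_matrix_def)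
  then have "R $$ (a, b) = mat_adjoint R $$ (a, b)" by simp
  also have "\<dots> = cnj (R $$ (b, a))" by (rule mat_adjoint_index[OF R assms(2,3)])
  finally show ?thesis .
qed

lemma density_matrix_sesq:
  assumes "density_matrix d R"
  shows "0 \<le> sesq d R x x"
proof -
  have "0 \<le> (R *\<^sub>v vec d x) \<bullet>c vec d x" and R: "R \<in> carrier_mat d d"
    using assms by (auto simp: density_matrix_def)
  then show ?thesis using mult_vec_cscalar_prod[OF R, of "vec d x" "vec d x"] by (simp add: sesq_vec)
qed

lemma sesq_cnj:
  assumes "density_matrix d R"
  shows "sesq d R y x = cnj (sesq d R x y)"
proof -
  have "cnj (sesq d R x y) = (\<Sum>a<d. \<Sum>b<d. x a * cnj (R $$ (a, b)) * cnj (y b))"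
    by (simp add: sesq_def)
  also have "\<dots> = (\<Sum>a<d. \<Sum>b<d. cnj (y b) * R $$ (b, a) * x a)"
    using density_matrix_cnj[OF assms] by (intro sum.cong refl) (metis lessThan_iff mult.assoc mult.commute)
  also have "\<dots> = sesq d R y x"
    unfolding sesq_def by (rule sum.swap)
  finally show ?thesis by simp
qed

lemma sesq_add_scaled:
  "sesq d R (\<lambda>i. s * x i + t * y i) (\<lambda>i. s * x i + t * y i) =
     cnj s * s * sesq d R x x + cnj s * t * sesq d R x y
     + cnj t * s * sesq d R y x + cnj t * t * sesq d R y y"
  unfolding sesq_def sum_distrib_left sum.distrib[symmetric]
  by (intro sum.cong refl) (simp add: algebra_simps)

text \<open>For \<open>p > 0\<close> the point \<open>s = m\<close>, \<open>t = p\<close> turns the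
  form into \<open>p * (p * q - m\<^sup>2)\<close>. For \<open>p = 0\<close> the form at
  \<open>t = 1\<close> is affine in \<open>s\<close> and bounded below, so its slope
  vanishes.\<close>

lemma quadratic_form_discriminant:
  fixes p q m :: real
  assumes "\<And>s t. 0 \<le> p * s\<^sup>2 - 2 * m * s * t + q * t\<^sup>2"
  shows "m\<^sup>2 \<le> p * q"
proof -
  have p: "0 \<le> p" using assms[of 1 0] by simp
  have q: "0 \<le> q" using assms[of 0 1] by simp
  show ?thesis
  proof (cases "p = 0")
    case True
    have "0 \<le> - 2 * m * s + q" for s using assms[of s 1] True by simp
    \<comment> \<open>For nonzero \<open>m\<close> this \<open>s\<close> gives the bound the value
      \<open>-1\<close>.\<close>
    from this[of "(q + 1) / (2 * m)"] have "m = 0" by (cases "m = 0") auto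
    with True show ?thesis by simp
  next
    case False
    have "0 \<le> p * m\<^sup>2 - 2 * m * m * p + q * p\<^sup>2" by (rule assms)
    then have "0 \<le> p * (p * q - m\<^sup>2)" by (simp add: algebra_simps power2_eq_square)
    with p False show ?thesis by (simp add: zero_le_mult_iff)
  qed
qed

text \<open>Rotating \<open>x\<close> by the phase of the mixed term makes that term real. The form
  at \<open>s u x - t y\<close> is then a nonnegative real quadratic form in \<open>s\<close> and
  \<open>t\<close>, to which the discriminant bound applies.\<close>

lemma density_matrix_cauchy_schwarz:
  assumes R: "density_matrix d R"
  shows "(cmod (sesq d R x y))\<^sup>2 \<le> Re (sesq d R x x) * Re (sesq d R y y)"
proof -
  define B where "B = sesq d R x y"
  \<comment> \<open>\<open>u\<close> is the phase of \<open>B\<close>, with the value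
    \<open>1\<close> when \<open>B = 0\<close>.\<close>
  obtain u where u: "cmod u = 1" "u * cmod B = B"
  proof (cases "B = 0")
    case True then show ?thesis using that[of 1] by simp
  next
    case False then show ?thesis using that[of "sgn B"] by (simp add: sgn_eq norm_divide)
  qed
  have uu: "cnj u * u = 1"
    using u(1) complex_norm_square[of u] by (simp add: mult.commute)
  have cB: "cnj u * B = cmod B" using u(2) uu by (metis mult.assoc mult_1)
  have cB': "u * cnj B = cmod B" using arg_cong[OF cB, of cnj] by simp
  have "0 \<le> Re (sesq d R x x) * s\<^sup>2 - 2 * cmod B * s * t + Re (sesq d R y y) * t\<^sup>2" for s t :: real
  proof -
    define z where "z = sesq d R (\<lambda>i. (of_real s * u) * x i + of_real (- t) * y i) (\<lambda>i. (of_real s * u) * x i + of_real (- t) * y i)"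
    have z0: "0 \<le> Re z"
      using density_matrix_sesq[OF R] unfolding z_def less_eq_complex_def by auto
    have "z = of_real (s\<^sup>2) * (cnj u * u) * sesq d R x x - of_real (s * t) * (cnj u * B)
        - of_real (s * t) * (u * cnj B) + of_real (t\<^sup>2) * sesq d R y y"
      unfolding z_def sesq_add_scaled sesq_cnj[OF R, of y x] B_def
      by (simp add: algebra_simps power2_eq_square)
    then have "Re z = s\<^sup>2 * Re (sesq d R x x) - 2 * (s * t) * cmod B + t\<^sup>2 * Re (sesq d R y y)"
      unfolding uu cB cB' by simp
    with z0 show ?thesis by (simp add: mult_ac)
  qed
  from quadratic_form_discriminant[OF this] show ?thesis unfolding B_def .
qed

lemma sesq_indicator:
  assumes "a < d" "b < d"
  shows "sesq d R (\<lambda>i. of_bool (i = a)) (\<lambda>i. of_bool (i = b)) = R $$ (a, b)"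
proof -
  have "sesq d R (\<lambda>i. of_bool (i = a)) (\<lambda>i. of_bool (i = b)) =
      (\<Sum>i<d. if i = a then (\<Sum>j<d. if j = b then R $$ (i, j) else 0) else 0)"
    unfolding sesq_def by (intro sum.cong refl) (auto intro!: sum.neutral sum.cong)
  then show ?thesis using assms by simp
qed

lemma density_matrix_entry_le:
  assumes "density_matrix d R" "a < d" "b < d"
  shows "(cmod (R $$ (a, b)))\<^sup>2 \<le> Re (R $$ (a, a)) * Re (R $$ (b, b))"
  using density_matrix_cauchy_schwarz[OF assms(1), of "\<lambda>i. of_bool (i = a)" "\<lambda>i. of_bool (i = b)"]
  by (simp add: sesq_indicator assms)

lemma density_matrix_diag:
  assumes "density_matrix d R" "a < d"
  shows "Im (R $$ (a, a)) = 0" "0 \<le> Re (R $$ (a, a))" "Re (R $$ (a, a)) \<le> 1"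
proof -
  have pos: "0 \<le> R $$ (i, i)" if "i < d" for i
    using density_matrix_sesq[OF assms(1), of "\<lambda>j. of_bool (j = i)"] that by (simp add: sesq_indicator)
  then show "Im (R $$ (a, a)) = 0" "0 \<le> Re (R $$ (a, a))"
    using assms(2) by (auto simp: less_eq_complex_def)
  have "Re (R $$ (a, a)) \<le> (\<Sum>i<d. Re (R $$ (i, i)))"
    using pos assms(2) by (intro member_le_sum) (auto simp: less_eq_complex_def)
  also have "\<dots> = 1"
    using assms(1) unfolding density_matrix_def by (metis Re_sum one_complex.sel(1))
  finally show "Re (R $$ (a, a)) \<le> 1" .
qed

text \<open>Trace one leaves nothing for the other diagonal entries, and an off-diagonal entry is
  bounded by the diagonal entries of its row and column. Thus one outcome of probability one
  determines the whole state.\<close>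

lemma density_matrix_eq_matrix_unit:
  assumes R: "density_matrix d R" and a: "a < d" and Raa: "R $$ (a, a) = 1"
  shows "R = matrix_unit d a a"
proof -
  have z: "Re (R $$ (i, i)) = 0" if i: "i < d" "i \<noteq> a" for i
  proof -
    have "1 = (\<Sum>i<d. Re (R $$ (i, i)))"
      using R unfolding density_matrix_def by (metis Re_sum one_complex.sel(1))
    also have "\<dots> = 1 + (\<Sum>i\<in>{..<d} - {a}. Re (R $$ (i, i)))"
      using a Raa by (subst sum.remove[of _ a]) auto
    finally have "(\<Sum>i\<in>{..<d} - {a}. Re (R $$ (i, i))) = 0" by simp
    then show ?thesis
      using i density_matrix_diag[OF R] by (subst (asm) sum_nonneg_eq_0_iff) auto
  qed
  have "R $$ (i, j) = 0" if "i < d" "j < d" "\<not> (i = a \<and> j = a)" for i j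
    using density_matrix_entry_le[OF R that(1,2)] z that by (cases "i = a") auto
  then show ?thesis
    using R a Raa by (intro eq_matI) (auto simp: matrix_unit_def density_matrix_def)
qed

text \<open>The last hypothesis says that the determinant is nonnegative. It bounds the mixed term
  of the form, and the rest is a square.\<close>

lemma density_matrix_2:
  assumes R: "R \<in> carrier_mat 2 2"
    and e: "R $$ (0, 0) = of_real p" "R $$ (1, 1) = 1 - of_real p" "R $$ (1, 0) = cnj (R $$ (0, 1))"
    and p: "0 \<le> p" "p \<le> 1" and b: "(cmod (R $$ (0, 1)))\<^sup>2 \<le> p * (1 - p)"
  shows "density_matrix 2 R"
proof (rule density_matrix_entries[OF R])
  show "R $$ (a, b) = cnj (R $$ (b, a))" if "a < 2" "b < 2" for a b
    using that e by (auto simp: less_2_cases_iff)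
  show "(\<Sum>i<2. R $$ (i, i)) = 1" unfolding sum_lessThan_2 e by simp
  fix x :: "nat \<Rightarrow> complex"
  define B where "B = R $$ (0, 1)"
  define w where "w = cnj (x 0) * B * x 1"
  have "sesq 2 R x x = cnj (x 0) * x 0 * p + cnj (x 1) * x 1 * (1 - p) + (w + cnj w)"
    unfolding sesq_def sum_lessThan_2 w_def B_def e by (simp add: algebra_simps)
  then have s: "sesq 2 R x x = of_real ((cmod (x 0))\<^sup>2 * p + (cmod (x 1))\<^sup>2 * (1 - p) + 2 * Re w)"
    by (simp add: complex_norm_square complex_add_cnj mult.commute del: of_real_power)
  have "cmod B \<le> sqrt p * sqrt (1 - p)"
    using b by (simp add: B_def real_le_rsqrt real_sqrt_mult[symmetric])
  then have "cmod w \<le> cmod (x 0) * (sqrt p * sqrt (1 - p)) * cmod (x 1)"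
    unfolding w_def norm_mult using p by (intro mult_mono) auto
  then have "- (cmod (x 0) * (sqrt p * sqrt (1 - p)) * cmod (x 1)) \<le> Re w"
    using abs_Re_le_cmod[of w] by linarith
  moreover have "0 \<le> (cmod (x 0) * sqrt p - cmod (x 1) * sqrt (1 - p))\<^sup>2" by simp
  ultimately have "0 \<le> (cmod (x 0))\<^sup>2 * p + (cmod (x 1))\<^sup>2 * (1 - p) + 2 * Re w"
    using p by (simp add: power2_diff power_mult_distrib mult_ac)
  then show "0 \<le> sesq 2 R x x" unfolding s by (simp add: less_eq_complex_def)
qed

section \<open>The Choi matrix\<close>

lemma matrix_unit_carrier [simp]: "matrix_unit d i j \<in> carrier_mat d d"
  by (simp add: matrix_unit_def)

lemma superoperator_carrier:
  "superoperator d F \<Longrightarrow> A \<in> carrier_mat d d \<Longrightarrow> F A \<in> carrier_mat d d"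
  by (auto simp: superoperator_def)

text \<open>Complete positivity speaks only of tensor extensions; the one-dimensional ancilla
  recovers positivity of \<open>F\<close> itself.\<close>

lemma tensor_superop_1:
  assumes F: "superoperator d F" and A: "A \<in> carrier_mat d d"
  shows "tensor_superop d 1 F id A = F A"
proof (rule eq_matI)
  fix a b assume "a < dim_row (F A)" "b < dim_col (F A)"
  then have ab: "a < d" "b < d" using superoperator_carrier[OF F A] by auto
  show "tensor_superop d 1 F id A $$ (a, b) = F A $$ (a, b)"
  proof -
    have "tensor_mat (F (matrix_unit d i j)) (matrix_unit 1 0 0) $$ (a, b) = F (matrix_unit d i j) $$ (a, b)" for i j
      using superoperator_carrier[OF F matrix_unit_carrier, of i j] ab
      by (auto simp: tensor_mat_def matrix_unit_def)
    then show ?thesis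
      unfolding superoperator_expand[OF F A ab] using ab by (simp add: tensor_superop_def)
  qed
qed (use superoperator_carrier[OF F A] in \<open>auto simp: tensor_superop_def\<close>)

lemma CPSO_superoperator: "CPSO d F \<Longrightarrow> superoperator d F"
  by (simp add: CPSO_def)

lemma CPSO_density_matrix:
  assumes "CPSO d F" "density_matrix d R"
  shows "density_matrix d (F R)"
proof -
  have "\<forall>M>0. PSO (d * M) (tensor_superop d M F id)" using assms(1) unfolding CPSO_def by (rule conjunct2)
  from spec[OF this, of 1] have "PSO (d * 1) (tensor_superop d 1 F id)" by simp
  then have "density_matrix d (tensor_superop d 1 F id R)" using assms(2) by (simp add: PSO_def)
  moreover have "R \<in> carrier_mat d d" using assms(2) by (simp add: density_matrix_def)
  ultimately show ?thesis using tensor_superop_1[OF CPSO_superoperator[OF assms(1)]] by metis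
qed

text \<open>The form of \<open>proj v\<close> at \<open>x\<close> is the squared modulus of the
  inner product of \<open>x\<close> and \<open>v\<close>.\<close>

lemma density_matrix_proj:
  assumes v: "v \<in> carrier_vec d" and n: "(\<Sum>i<d. v $ i * cnj (v $ i)) = 1"
  shows "density_matrix d (proj v)"
proof (rule density_matrix_entries)
  fix x :: "nat \<Rightarrow> complex"
  define c where "c = (\<Sum>i<d. cnj (x i) * v $ i)"
  have "sesq d (proj v) x x = (\<Sum>a<d. \<Sum>b<d. (cnj (x a) * v $ a) * cnj (cnj (x b) * v $ b))"
    using v unfolding sesq_def proj_def by (intro sum.cong refl) (auto simp: mult_ac)
  also have "\<dots> = c * cnj c"
    unfolding c_def cnj_sum sum_product ..
  finally show "0 \<le> sesq d (proj v) x x"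
    by (simp add: complex_norm_square[symmetric] less_eq_complex_def del: of_real_power)
qed (use v n in \<open>auto simp: proj_def\<close>)

text \<open>The image of the maximally entangled state under \<open>F\<close> tensored with the
  identity. In an index \<open>r\<close>, \<open>r div d\<close> is the output index and
  \<open>r mod d\<close> the input index; dividing by \<open>d\<close> makes the trace
  \<open>1\<close>.\<close>

definition choi :: "nat \<Rightarrow> (complex mat \<Rightarrow> complex mat) \<Rightarrow> complex mat" where
  "choi d F = mat (d * d) (d * d)
     (\<lambda>(r, c). F (matrix_unit d (r mod d) (c mod d)) $$ (r div d, c div d) / of_nat d)"

lemma density_matrix_choi:
  assumes F: "CPSO d F" and d: "0 < d"
  shows "density_matrix (d * d) (choi d F)"
proof -
  \<comment> \<open>The maximally entangled unit vector: equal amplitudes on the doubled basis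
    states.\<close>
  define \<psi> where "\<psi> = vec (d * d) (\<lambda>r. if r div d = r mod d then complex_of_real (1 / sqrt d) else 0)"
  have sq: "complex_of_real (sqrt d) * complex_of_real (sqrt d) = of_nat d"
    by (metis of_real_mult of_real_of_nat_eq real_sqrt_mult_self abs_of_nat)
  have "(\<Sum>r<d * d. \<psi> $ r * cnj (\<psi> $ r)) = (\<Sum>r<d * d. if r div d = r mod d then 1 / of_nat d else 0)"
    using d by (intro sum.cong refl) (auto simp: \<psi>_def sq)
  also have "\<dots> = (\<Sum>i<d. \<Sum>k<d. if i = k then 1 / of_nat d else 0)"
    by (rule sum_div_mod[of "\<lambda>i k. if i = k then 1 / of_nat d else 0"])
  also have "\<dots> = 1" using d by simp
  finally have "density_matrix (d * d) (proj \<psi>)"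
    by (intro density_matrix_proj) (simp add: \<psi>_def)
  moreover have "PSO (d * d) (tensor_superop d d F id)" using F d by (simp add: CPSO_def)
  ultimately have "density_matrix (d * d) (tensor_superop d d F id (proj \<psi>))"
    by (simp add: PSO_def)
  moreover have "tensor_superop d d F id (proj \<psi>) = choi d F"
  proof (rule eq_matI)
    fix r c assume "r < dim_row (choi d F)" "c < dim_col (choi d F)"
    then have rc: "r < d * d" "c < d * d" by (auto simp: choi_def)
    have T: "tensor_mat (F (matrix_unit d i j)) (matrix_unit d k l) $$ (r, c) =
        F (matrix_unit d i j) $$ (r div d, c div d) * of_bool (r mod d = k \<and> c mod d = l)" for i j k l
      using superoperator_carrier[OF CPSO_superoperator[OF F] matrix_unit_carrier, of i j] rc d
      by (auto simp: tensor_mat_def matrix_unit_def)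
    \<comment> \<open>The identity on the second factor fixes \<open>k\<close> and \<open>l\<close>,
      and the entanglement of \<open>\<psi>\<close> forces \<open>i = k\<close> and
      \<open>j = l\<close>, so one term survives.\<close>
    have "tensor_superop d d F id (proj \<psi>) $$ (r, c) = (\<Sum>i<d. \<Sum>j<d. \<Sum>k<d. \<Sum>l<d.
        if k = r mod d then if l = c mod d then if i = k then if j = l then
          F (matrix_unit d i j) $$ (r div d, c div d) / of_nat d else 0 else 0 else 0 else 0)"
      unfolding tensor_superop_def using rc d
      by (auto simp: proj_def \<psi>_def T idx_bound sq intro!: sum.cong)
    also have "\<dots> = choi d F $$ (r, c)"
      using d rc by (simp add: sum_delta_2 choi_def)
    finally show "tensor_superop d d F id (proj \<psi>) $$ (r, c) = choi d F $$ (r, c)" .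
  qed (auto simp: tensor_superop_def choi_def)
  ultimately show ?thesis by simp
qed

text \<open>The two vectors are \<open>x\<close> tensored with the basis vector \<open>k\<close> and
  \<open>y\<close> tensored with the basis vector \<open>l\<close>; they cut the block
  \<open>(k, l)\<close> out of the Choi matrix.\<close>

lemma sesq_choi:
  assumes kl: "k < d" "l < d"
  shows "sesq (d * d) (choi d F) (\<lambda>r. if r mod d = k then x (r div d) else 0)
      (\<lambda>r. if r mod d = l then y (r div d) else 0) = sesq d (F (matrix_unit d k l)) x y / of_nat d"
proof -
  define t where "t a k' b l' = (if k' = k then if l' = l then cnj (x a) * (F (matrix_unit d k' l') $$ (a, b) / of_nat d) * y b else 0 else 0)"
    for a k' b l'
  have "sesq (d * d) (choi d F) (\<lambda>r. if r mod d = k then x (r div d) else 0)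
      (\<lambda>r. if r mod d = l then y (r div d) else 0) =
      (\<Sum>r<d * d. \<Sum>c<d * d. t (r div d) (r mod d) (c div d) (c mod d))"
    unfolding sesq_def by (intro sum.cong refl) (auto simp: choi_def t_def)
  also have "\<dots> = (\<Sum>r<d * d. \<Sum>b<d. \<Sum>l'<d. t (r div d) (r mod d) b l')"
    by (rule sum.cong[OF refl]) (rule sum_div_mod)
  also have "\<dots> = (\<Sum>a<d. \<Sum>k'<d. \<Sum>b<d. \<Sum>l'<d. t a k' b l')"
    by (rule sum_div_mod[of "\<lambda>a k'. \<Sum>b<d. \<Sum>l'<d. t a k' b l'"])
  also have "\<dots> = (\<Sum>a<d. \<Sum>b<d. cnj (x a) * (F (matrix_unit d k l) $$ (a, b) / of_nat d) * y b)"
  proof (rule sum.cong[OF refl])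
    fix a
    have "(\<Sum>k'<d. \<Sum>b<d. \<Sum>l'<d. t a k' b l') = (\<Sum>b<d. \<Sum>k'<d. \<Sum>l'<d. t a k' b l')"
      by (rule sum.swap)
    then show "(\<Sum>k'<d. \<Sum>b<d. \<Sum>l'<d. t a k' b l') =
       (\<Sum>b<d. cnj (x a) * (F (matrix_unit d k l) $$ (a, b) / of_nat d) * y b)"
      using kl by (simp add: t_def sum_delta_2)
  qed
  finally show ?thesis
    by (simp add: sesq_def sum_divide_distrib)
qed

text \<open>Cauchy-Schwarz for the Choi matrix at these product vectors; both sides carry the same
  factor \<open>1 / d\<close> squared, which cancels.\<close>

lemma CPSO_cauchy_schwarz:
  assumes F: "CPSO d F" and kl: "k < d" "l < d"
  shows "(cmod (sesq d (F (matrix_unit d k l)) x y))\<^sup>2 \<le>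
    Re (sesq d (F (matrix_unit d k k)) x x) * Re (sesq d (F (matrix_unit d l l)) y y)"
proof -
  have d: "0 < d" using kl by simp
  have "(cmod (sesq d (F (matrix_unit d k l)) x y / of_nat d))\<^sup>2 \<le>
    Re (sesq d (F (matrix_unit d k k)) x x / of_nat d) * Re (sesq d (F (matrix_unit d l l)) y y / of_nat d)"
    using density_matrix_cauchy_schwarz[OF density_matrix_choi[OF F d],
        of "\<lambda>r. if r mod d = k then x (r div d) else 0" "\<lambda>r. if r mod d = l then y (r div d) else 0"]
    unfolding sesq_choi[OF kl] sesq_choi[OF kl(1) kl(1)] sesq_choi[OF kl(2) kl(2)] .
  then show ?thesis using d
    by (simp add: norm_divide power_divide Re_divide_of_nat divide_simps power2_eq_square)
qed

text \<open>This is the Hermitian symmetry of the Choi matrix.\<close>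

lemma CPSO_cnj:
  assumes F: "CPSO d F" and kl: "k < d" "l < d" and ab: "a < d" "b < d"
  shows "F (matrix_unit d k l) $$ (a, b) = cnj (F (matrix_unit d l k) $$ (b, a))"
proof -
  have d: "0 < d" using kl by simp
  show ?thesis
    using density_matrix_cnj[OF density_matrix_choi[OF F d], of "a * d + k" "b * d + l"] kl ab d
    by (simp add: choi_def idx_bound)
qed

section \<open>Probabilities as diagonal entries, superoperators on matrix units\<close>

lemma sesq_cong:
  assumes "\<And>i. i < d \<Longrightarrow> x i = x' i" "\<And>i. i < d \<Longrightarrow> y i = y' i"
  shows "sesq d R x y = sesq d R x' y'"
  unfolding sesq_def using assms by (intro sum.cong refl) simp

lemma Pr_eq_diag:
  assumes "ket w = unit_vec d i" "i < d" "R \<in> carrier_mat d d"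
  shows "Pr w R = R $$ (i, i)"
proof -
  have "Pr w R = sesq d R (($) (unit_vec d i)) (($) (unit_vec d i))"
    unfolding Pr_def assms(1) using assms(3) by (intro mult_vec_cscalar_prod) auto
  also have "\<dots> = sesq d R (\<lambda>j. of_bool (j = i)) (\<lambda>j. of_bool (j = i))"
    using assms(2) by (intro sesq_cong) (auto simp: unit_vec_def)
  finally show ?thesis using assms(2) by (simp add: sesq_indicator)
qed

lemma proj_unit_vec: "proj (unit_vec d i) = matrix_unit d i i"
  by (intro eq_matI) (auto simp: proj_def matrix_unit_def unit_vec_def)

lemma density_matrix_matrix_unit: "i < d \<Longrightarrow> density_matrix d (matrix_unit d i i)"
  using density_matrix_proj[of "unit_vec d i" d] unfolding proj_unit_vec
  by (simp add: unit_vec_def if_distrib cong: if_cong)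

lemma superop_eqI:
  assumes F: "superoperator d F" and G: "superoperator d G"
    and eq: "\<And>k l a b. k < d \<Longrightarrow> l < d \<Longrightarrow> a < d \<Longrightarrow> b < d \<Longrightarrow>
      F (matrix_unit d k l) $$ (a, b) = G (matrix_unit d k l) $$ (a, b)"
  shows "superop_eq d F G"
  unfolding superop_eq_def
proof
  fix A :: "complex mat" assume A: "A \<in> carrier_mat d d"
  show "F A = G A"
  proof (rule eq_matI)
    fix a b assume "a < dim_row (G A)" "b < dim_col (G A)"
    then have ab: "a < d" "b < d" using superoperator_carrier[OF G A] by auto
    show "F A $$ (a, b) = G A $$ (a, b)"
      unfolding superoperator_expand[OF F A ab] superoperator_expand[OF G A ab]
      using ab eq by simp
  qed (use superoperator_carrier[OF F A] superoperator_carrier[OF G A] in auto)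
qed

lemma unitary_superop_index:
  assumes A: "A \<in> carrier_mat d d" and R: "R \<in> carrier_mat d d" and ab: "a < d" "b < d"
  shows "unitary_superop A R $$ (a, b) = (\<Sum>k<d. \<Sum>l<d. A $$ (a, k) * R $$ (k, l) * cnj (A $$ (b, l)))"
proof -
  have "unitary_superop A R $$ (a, b) = (\<Sum>l<d. (\<Sum>k<d. A $$ (a, k) * R $$ (k, l)) * cnj (A $$ (b, l)))"
    using A R ab mat_adjoint_index[OF A]
    by (simp add: unitary_superop_def scalar_prod_def atLeast0LessThan)
  then show ?thesis
    by (simp add: sum_distrib_right) (rule sum.swap)
qed

lemma unitary_superop_carrier:
  "A \<in> carrier_mat d d \<Longrightarrow> unitary_superop A R \<in> carrier_mat d d"
  by (auto simp: unitary_superop_def)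

lemma superoperator_unitary:
  assumes A: "A \<in> carrier_mat d d"
  shows "superoperator d (unitary_superop A)"
proof -
  have A': "mat_adjoint A \<in> carrier_mat d d" using A by auto
  show ?thesis
    unfolding superoperator_def
  proof (intro conjI ballI allI)
    show "unitary_superop A \<in> carrier_mat d d \<rightarrow> carrier_mat d d"
      using unitary_superop_carrier[OF A] by auto
    show "unitary_superop A (R + S) = unitary_superop A R + unitary_superop A S"
      if "R \<in> carrier_mat d d" "S \<in> carrier_mat d d" for R S
      using that A A' unfolding unitary_superop_def
      by (simp add: mult_add_distrib_mat[OF A] add_mult_distrib_mat[of _ d d _ _ d])
    show "unitary_superop A (c \<cdot>\<^sub>m R) = c \<cdot>\<^sub>m unitary_superop A R"
      if "R \<in> carrier_mat d d" for c R
      using that A A' unfolding unitary_superop_def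
      by (simp add: mult_smult_distrib[OF A] mult_smult_assoc_mat[of _ d d _ d])
  qed
qed

lemma unitary_superop_matrix_unit:
  assumes A: "A \<in> carrier_mat d d" and "k < d" "l < d" "a < d" "b < d"
  shows "unitary_superop A (matrix_unit d k l) $$ (a, b) = A $$ (a, k) * cnj (A $$ (b, l))"
proof -
  have "unitary_superop A (matrix_unit d k l) $$ (a, b) =
      (\<Sum>i<d. \<Sum>j<d. if i = k then if j = l then A $$ (a, i) * cnj (A $$ (b, j)) else 0 else 0)"
    unfolding unitary_superop_index[OF A matrix_unit_carrier assms(4,5)]
    by (intro sum.cong refl) (auto simp: matrix_unit_def)
  then show ?thesis using assms(2,3) by (simp add: sum_delta_2)
qed

section \<open>The Hadamard gates\<close>

lemma sesq_2:
  "sesq 2 R x y = cnj (x 0) * R $$ (0, 0) * y 0 + cnj (x 0) * R $$ (0, 1) * y 1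
     + cnj (x 1) * R $$ (1, 0) * y 0 + cnj (x 1) * R $$ (1, 1) * y 1"
  by (simp add: sesq_def sum_lessThan_2)

lemma one_less_2: "(1::nat) < 2"
  by simp

text \<open>The traceless Hermitian matrix \<open>R - S\<close> has as eigenvalues plus and minus
  the square root of the right-hand side, which is therefore the squared trace distance.
  \<open>F\<close> cannot increase it, and the images have distance \<open>1\<close>.\<close>

lemma CPSO_antipodal:
  assumes F: "CPSO 2 F" and R: "density_matrix 2 R" and S: "density_matrix 2 S"
    and FR: "F R = matrix_unit 2 0 0" and FS: "F S = matrix_unit 2 1 1"
  shows "1 \<le> (Re (R $$ (0, 0) - S $$ (0, 0)))\<^sup>2 + (cmod (R $$ (0, 1) - S $$ (0, 1)))\<^sup>2"
proof (rule ccontr)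
  define t where "t = Re (R $$ (0, 0) - S $$ (0, 0))"
  define \<beta> where "\<beta> = R $$ (0, 1) - S $$ (0, 1)"
  define N where "N = t\<^sup>2 + (cmod \<beta>)\<^sup>2"
  \<comment> \<open>Needed are \<open>s > 1\<close> and \<open>s\<^sup>2 * N \<le> 1\<close>. This
    choice gives both from \<open>0 \<le> N < 1\<close>, including \<open>N = 0\<close>.\<close>
  define s where "s = 2 / (1 + N)"
  assume "\<not> ?thesis"
  then have N: "N < 1" by (simp add: N_def t_def \<beta>_def)
  have N0: "0 \<le> N" by (simp add: N_def)
  have s1: "1 < s" using N N0 by (simp add: s_def)
  have "4 * N \<le> (1 + N)\<^sup>2"
    using zero_le_power2[of "1 - N"] by (simp add: power2_eq_square algebra_simps)
  then have sN: "s\<^sup>2 * N \<le> 1"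
    using N0 by (simp add: s_def power_divide divide_simps)
  have Rc: "R \<in> carrier_mat 2 2" and Sc: "S \<in> carrier_mat 2 2"
    using R S by (auto simp: density_matrix_def)
  have tr: "R $$ (0, 0) + R $$ (1, 1) = 1" "S $$ (0, 0) + S $$ (1, 1) = 1"
    using R S unfolding density_matrix_def sum_lessThan_2 by blast+
  have t: "R $$ (0, 0) - S $$ (0, 0) = of_real t"
    using density_matrix_diag(1)[OF R, of 0] density_matrix_diag(1)[OF S, of 0]
    by (simp add: t_def complex_eq_iff)
  have t': "R $$ (1, 1) - S $$ (1, 1) = - of_real t"
  proof -
    have "R $$ (1, 1) - S $$ (1, 1) = (1 - R $$ (0, 0)) - (1 - S $$ (0, 0))"
      by (subst tr(1)[symmetric], subst tr(2)[symmetric]) (simp del: One_nat_def)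
    then show ?thesis unfolding t[symmetric] by simp
  qed
  have \<beta>': "R $$ (1, 0) - S $$ (1, 0) = cnj \<beta>"
    using density_matrix_cnj[OF R, of 1 0] density_matrix_cnj[OF S, of 1 0] by (simp add: \<beta>_def)
  \<comment> \<open>If the distance were below \<open>1\<close>, the traceless difference \<open>R - S\<close> could be enlarged by \<open>s > 1\<close> and
    still be a difference of two density matrices, but its image has diagonal \<open>(s, -s)\<close>.\<close>
  define A where "A \<sigma> = mat 2 2 (\<lambda>(i, j). of_bool (i = j) / 2
    + complex_of_real (\<sigma> * s / 2) * (R $$ (i, j) - S $$ (i, j)))" for \<sigma>
  have AE: "A \<sigma> $$ (i, j) = of_bool (i = j) / 2 + complex_of_real (\<sigma> * s / 2) * (R $$ (i, j) - S $$ (i, j))"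
    if "i < 2" "j < 2" for \<sigma> i j
    using that by (simp add: A_def)
  have A: "density_matrix 2 (A \<sigma>)" if "\<sigma>\<^sup>2 = 1" for \<sigma>
  proof (rule density_matrix_2)
    let ?p = "(1 + \<sigma> * s * t) / 2"
    have st: "(\<sigma> * s * t)\<^sup>2 + s\<^sup>2 * (cmod \<beta>)\<^sup>2 \<le> 1"
      using sN that by (simp add: N_def power_mult_distrib algebra_simps)
    have "0 \<le> s\<^sup>2 * (cmod \<beta>)\<^sup>2" by simp
    with st have "(\<sigma> * s * t)\<^sup>2 \<le> 1" by linarith
    then have "\<bar>\<sigma> * s * t\<bar> \<le> 1" by (simp add: abs_square_le_1)
    then show "0 \<le> ?p" "?p \<le> 1" by auto
    show "A \<sigma> $$ (0, 0) = of_real ?p" "A \<sigma> $$ (1, 1) = 1 - of_real ?p"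
      unfolding AE[OF pos2 pos2] AE[OF one_less_2 one_less_2] t t' by (simp_all add: field_simps)
    show "A \<sigma> $$ (1, 0) = cnj (A \<sigma> $$ (0, 1))"
      using \<beta>' by (simp add: A_def \<beta>_def)
    have "(cmod (A \<sigma> $$ (0, 1)))\<^sup>2 = s\<^sup>2 * (cmod \<beta>)\<^sup>2 / 4"
      using that by (simp add: A_def \<beta>_def norm_mult power_mult_distrib power_divide norm_divide)
    also have "\<dots> \<le> ?p * (1 - ?p)"
      using st by (simp add: field_simps power2_eq_square)
    finally show "(cmod (A \<sigma> $$ (0, 1)))\<^sup>2 \<le> ?p * (1 - ?p)" .
  qed (simp add: A_def)
  have Ac: "A \<sigma> \<in> carrier_mat 2 2" for \<sigma> by (simp add: A_def)
  \<comment> \<open>This is \<open>A 1 - A (-1) = s (R - S)\<close>, arranged with sums to match the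
    linearity clauses.\<close>
  have "A 1 + of_real s \<cdot>\<^sub>m S = A (-1) + of_real s \<cdot>\<^sub>m R"
    using Rc Sc by (intro eq_matI) (auto simp: A_def algebra_simps)
  then have "F (A 1 + of_real s \<cdot>\<^sub>m S) = F (A (-1) + of_real s \<cdot>\<^sub>m R)" by simp
  then have "F (A 1) + of_real s \<cdot>\<^sub>m F S = F (A (-1)) + of_real s \<cdot>\<^sub>m F R"
    using CPSO_superoperator[OF F] Ac Rc Sc by (simp add: superoperator_def)
  then have "(F (A 1) + of_real s \<cdot>\<^sub>m F S) $$ (0, 0) = (F (A (-1)) + of_real s \<cdot>\<^sub>m F R) $$ (0, 0)" by simp
  then have "F (A 1) $$ (0, 0) = F (A (-1)) $$ (0, 0) + of_real s"
    unfolding FR FS by (simp add: matrix_unit_def)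
  then have "Re (F (A 1) $$ (0, 0)) = Re (F (A (-1)) $$ (0, 0)) + s" by simp
  moreover have "Re (F (A 1) $$ (0, 0)) \<le> 1" "0 \<le> Re (F (A (-1)) $$ (0, 0))"
    by (rule density_matrix_diag[OF CPSO_density_matrix[OF F A]]; simp)+
  ultimately show False using s1 by linarith
qed

lemma H_gate_index:
  "H_gate \<phi> $$ (0, 0) = 1 / sqrt 2" "H_gate \<phi> $$ (0, 1) = cis (-\<phi>) / sqrt 2"
  "H_gate \<phi> $$ (1, 0) = cis \<phi> / sqrt 2" "H_gate \<phi> $$ (1, 1) = - 1 / sqrt 2"
  by (simp_all add: H_gate_def mat_of_rows_list_def)

text \<open>The angle is the phase of an off-diagonal entry of the image of the first basis state.
  The images of both basis states are found first, then the image of the off-diagonal unit.\<close>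

lemma CPSO_eq_H_gate:
  assumes F: "CPSO 2 F"
    and e1: "Pr [0] (F (proj (ket [0]))) = 1 / 2"
    and e2: "Pr [0] ((F \<circ> F) (proj (ket [0]))) = 1"
    and e3: "Pr [0] ((F \<circ> F) (proj (ket [1]))) = 0"
  shows "\<exists>\<phi> \<in> {0..<2 * pi}. superop_eq 2 F (unitary_superop (H_gate \<phi>))"
proof -
  note SF = CPSO_superoperator[OF F]
  define E where "E k l = F (matrix_unit 2 k l)" for k l
  have Ec: "E k l \<in> carrier_mat 2 2" for k l
    unfolding E_def by (rule superoperator_carrier[OF SF matrix_unit_carrier])
  have d0: "density_matrix 2 (E 0 0)" and d1: "density_matrix 2 (E 1 1)"
    unfolding E_def by (rule CPSO_density_matrix[OF F density_matrix_matrix_unit], simp)+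
  note dF0 = CPSO_density_matrix[OF F d0] and dF1 = CPSO_density_matrix[OF F d1]
  have FEc: "F (E k l) \<in> carrier_mat 2 2" for k l by (rule superoperator_carrier[OF SF Ec])
  have tr: "R $$ (0, 0) + R $$ (1, 1) = 1" if "density_matrix 2 R" for R
    using that unfolding density_matrix_def sum_lessThan_2 by blast
  have h: "E 0 0 $$ (0, 0) = 1 / 2" "F (E 0 0) $$ (0, 0) = 1" "F (E 1 1) $$ (0, 0) = 0"
    using e1 e2 e3 Pr_eq_diag[OF ket_1[of 0] pos2 Ec] Pr_eq_diag[OF ket_1[of 0] pos2 FEc]
    unfolding ket_1 proj_unit_vec comp_def E_def by simp_all
  have F0: "F (E 0 0) = matrix_unit 2 0 0"
    by (rule density_matrix_eq_matrix_unit[OF dF0]) (simp_all add: h)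
  have F1: "F (E 1 1) = matrix_unit 2 1 1"
    by (rule density_matrix_eq_matrix_unit[OF dF1]) (use tr[OF dF1] h in simp_all)
  define b where "b = E 0 0 $$ (0, 1)"
  define q where "q = E 1 1 $$ (0, 1)"
  define p where "p = Re (E 1 1 $$ (0, 0))"
  have p: "E 1 1 $$ (0, 0) = of_real p"
    using density_matrix_diag(1)[OF d1, of 0] by (simp add: p_def complex_eq_iff)
  have p': "E 1 1 $$ (1, 1) = 1 - of_real p"
    using tr[OF d1] p by (simp add: algebra_simps)
  have h': "E 0 0 $$ (1, 1) = 1 / 2"
    using tr[OF d0] h(1) by (simp add: field_simps)
  have b2: "(cmod b)\<^sup>2 \<le> 1 / 4"
    using density_matrix_entry_le[OF d0 pos2 one_less_2] unfolding h(1) h' b_def by simp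
  have q2: "(cmod q)\<^sup>2 \<le> p * (1 - p)"
    using density_matrix_entry_le[OF d1, of 0 1] p p' by (simp add: q_def)
  \<comment> \<open>With \<open>far\<close>, the parallelogram law leaves no slack in \<open>b2\<close> and \<open>q2\<close>.\<close>
  have far: "1 \<le> (1 / 2 - p)\<^sup>2 + (cmod (b - q))\<^sup>2"
    using CPSO_antipodal[OF F d0 d1 F0 F1] unfolding h(1) p b_def[symmetric] q_def[symmetric] by simp
  have par: "(cmod (b - q))\<^sup>2 + (cmod (b + q))\<^sup>2 = 2 * (cmod b)\<^sup>2 + 2 * (cmod q)\<^sup>2"
    unfolding cmod_power2 by (simp add: power2_eq_square algebra_simps)
  \<comment> \<open>Here \<open>p * (1 - p) = 1 / 4 - (p - 1 / 2)\<^sup>2\<close> turns the bound on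
    \<open>q\<close> into a second square.\<close>
  have "(cmod (b + q))\<^sup>2 + (p - 1 / 2)\<^sup>2 \<le> 0"
    using far par b2 q2 by (simp add: power2_eq_square algebra_simps)
  moreover have "0 \<le> (cmod (b + q))\<^sup>2" "0 \<le> (p - 1 / 2)\<^sup>2" by simp_all
  ultimately have "(cmod (b + q))\<^sup>2 = 0" "(p - 1 / 2)\<^sup>2 = 0" by linarith+
  then have qb: "q = - b" and ph: "p = 1 / 2"
    by (simp_all add: add_eq_0_iff)
  have b1: "cmod (2 * b) = 1"
  proof -
    have "(cmod (2 * b))\<^sup>2 = 1"
      using far b2 unfolding qb ph by (simp add: norm_mult power_mult_distrib)
    then have "cmod (2 * b) = 1 \<or> cmod (2 * b) = - 1" by (simp only: power2_eq_1_iff)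
    with norm_ge_zero[of "2 * b"] show ?thesis by linarith
  qed
  \<comment> \<open>The entry \<open>(1, 0)\<close> of \<open>E 0 0\<close> is
    \<open>\<omega> / 2\<close>, and for the gate it is \<open>cis \<phi> / 2\<close>.\<close>
  define \<omega> where "\<omega> = cnj (2 * b)"
  have \<omega>1: "cmod \<omega> = 1" using b1 by (simp add: \<omega>_def)
  then have "(Re \<omega>)\<^sup>2 + (Im \<omega>)\<^sup>2 = 1" by (simp add: cmod_power2[symmetric])
  then obtain \<phi> where \<phi>: "0 \<le> \<phi>" "\<phi> < 2 * pi" "Re \<omega> = cos \<phi>" "Im \<omega> = sin \<phi>"
    using sincos_total_2pi by metis
  then have cis: "cis \<phi> = \<omega>" by (simp add: complex_eq_iff)
  have cis': "cis (-\<phi>) = cnj \<omega>" using cis by (metis cis_cnj)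
  have \<omega>\<omega>: "\<omega> * cnj \<omega> = 1" using \<omega>1 by (simp add: complex_norm_square[symmetric])
  have cancel: "\<omega> * (cnj \<omega> * z) = z" "cnj \<omega> * (\<omega> * z) = z" for z
    using \<omega>\<omega> by (metis mult.assoc mult.commute mult_1)+
  have E00: "E 0 0 $$ (0, 0) = 1 / 2" "E 0 0 $$ (0, 1) = cnj \<omega> / 2"
    "E 0 0 $$ (1, 0) = \<omega> / 2" "E 0 0 $$ (1, 1) = 1 / 2"
    using h h' density_matrix_cnj[OF d0, of 1 0] by (simp_all add: \<omega>_def b_def)
  have E11: "E 1 1 $$ (0, 0) = 1 / 2" "E 1 1 $$ (0, 1) = - cnj \<omega> / 2"
    "E 1 1 $$ (1, 0) = - \<omega> / 2" "E 1 1 $$ (1, 1) = 1 / 2"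
    using p p' ph qb density_matrix_cnj[OF d1, of 1 0] by (simp_all add: \<omega>_def b_def q_def)
  define X where "X = E 0 1"
  have E10: "E 1 0 $$ (i, j) = cnj (X $$ (j, i))" if "i < 2" "j < 2" for i j
    unfolding X_def E_def by (rule CPSO_cnj[OF F]) (use that in auto)
  \<comment> \<open>\<open>(1, -\<omega>)\<close> spans the kernel of \<open>E 0 0\<close> and \<open>(1, \<omega>)\<close> that of \<open>E 1 1\<close>.\<close>
  have "Re (sesq 2 (E 0 0) (\<lambda>i. if i = 0 then 1 else - \<omega>) (\<lambda>i. if i = 0 then 1 else - \<omega>)) = 0"
    unfolding sesq_2 E00 using \<omega>\<omega> by (simp add: mult.commute)
  then have "sesq 2 X (\<lambda>i. if i = 0 then 1 else - \<omega>) y = 0" for y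
    using CPSO_cauchy_schwarz[OF F, of 0 1 "\<lambda>i. if i = 0 then 1 else - \<omega>" y]
    by (simp add: E_def X_def)
  note row = this
  have r0: "X $$ (0, 0) = cnj \<omega> * X $$ (1, 0)"
    using row[of "\<lambda>i. of_bool (i = 0)"] by (simp add: sesq_def sum_lessThan_2)
  have "Re (sesq 2 (E 1 1) (\<lambda>i. if i = 0 then 1 else \<omega>) (\<lambda>i. if i = 0 then 1 else \<omega>)) = 0"
    unfolding sesq_2 E11 using \<omega>\<omega> by (simp add: mult.commute)
  then have "sesq 2 X x (\<lambda>i. if i = 0 then 1 else \<omega>) = 0" for x
    using CPSO_cauchy_schwarz[OF F, of 0 1 x "\<lambda>i. if i = 0 then 1 else \<omega>"]
    by (simp add: E_def X_def)
  note col = this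
  have c0: "X $$ (0, 0) + X $$ (0, 1) * \<omega> = 0"
    using col[of "\<lambda>i. of_bool (i = 0)"] by (simp add: sesq_def sum_lessThan_2)
  have c1: "X $$ (1, 0) + X $$ (1, 1) * \<omega> = 0"
    using col[of "\<lambda>i. of_bool (i = 1)"] by (simp add: sesq_def sum_lessThan_2)
  \<comment> \<open>The kernel relations make \<open>X\<close> equal to \<open>t\<close> times the
    matrix with rows \<open>(\<omega>, -1)\<close> and
    \<open>(\<omega> * \<omega>, -\<omega>)\<close>; the gate has \<open>t = 1 / 2\<close>.\<close>
  define t where "t = cnj \<omega> * X $$ (0, 0)"
  have x00: "X $$ (0, 0) = \<omega> * t" by (simp add: t_def cancel)
  have x10: "X $$ (1, 0) = \<omega> * (\<omega> * t)" using r0 x00 cancel by metis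
  have x01: "X $$ (0, 1) = - t"
  proof -
    have "X $$ (0, 1) * \<omega> = - (\<omega> * t)" using c0 x00 by (simp add: add_eq_0_iff)
    then have "cnj \<omega> * (\<omega> * X $$ (0, 1)) = - (cnj \<omega> * (\<omega> * t))" by (simp add: mult.commute)
    then show ?thesis by (simp only: cancel)
  qed
  have x11: "X $$ (1, 1) = - (\<omega> * t)"
  proof -
    have "X $$ (1, 1) * \<omega> = - (\<omega> * (\<omega> * t))" using c1 x10 by (simp add: add_eq_0_iff)
    then have "cnj \<omega> * (\<omega> * X $$ (1, 1)) = - (cnj \<omega> * (\<omega> * (\<omega> * t)))" by (simp add: mult.commute)
    then show ?thesis by (simp only: cancel)
  qed
  have ex: "F A $$ (i, j) = A $$ (0, 0) * E 0 0 $$ (i, j) + A $$ (0, 1) * X $$ (i, j)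
      + A $$ (1, 0) * cnj (X $$ (j, i)) + A $$ (1, 1) * E 1 1 $$ (i, j)"
    if "A \<in> carrier_mat 2 2" "i < 2" "j < 2" for A i j
    using superoperator_expand[OF SF that] E10[OF that(2,3)]
    by (simp add: sum_lessThan_2 E_def X_def)
  \<comment> \<open>The difference \<open>E 0 0 - E 1 1\<close> is purely off-diagonal, so its image
    involves only \<open>X\<close> and its adjoint. That image is known to be diagonal with entries
    \<open>1\<close> and \<open>-1\<close>, which gives the real and the imaginary part of
    \<open>t\<close>.\<close>
  have "F (E 0 0) $$ (0, 0) - F (E 1 1) $$ (0, 0) = t + cnj t"
    unfolding ex[OF Ec pos2 pos2] E00 E11 x00
    by (simp add: cancel)
  then have t1: "t + cnj t = 1" unfolding F0 F1 by (simp add: matrix_unit_def)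
  have "F (E 0 0) $$ (0, 1) - F (E 1 1) $$ (0, 1) = cnj \<omega> * (cnj t - t)"
    unfolding ex[OF Ec pos2 one_less_2] E00 E11 x01 x10
    by (simp add: cancel algebra_simps)
  then have "cnj \<omega> * (cnj t - t) = 0" unfolding F0 F1 by (simp add: matrix_unit_def)
  then have "cnj t = t" using \<omega>1 by auto
  with t1 have t: "t = 1 / 2" by (simp add: mult_2[symmetric] field_simps)
  define r where "r = complex_of_real (1 / sqrt 2)"
  have r: "cnj r = r" "r * r = 1 / 2"
    by (simp_all add: r_def flip: of_real_mult)
  have rr: "r * (r * z) = z / 2" for z
    using r(2) by (metis mult.assoc mult_1 times_divide_eq_left)
  have H: "H_gate \<phi> $$ (0, 0) = r" "H_gate \<phi> $$ (0, 1) = cnj \<omega> * r"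
    "H_gate \<phi> $$ (1, 0) = \<omega> * r" "H_gate \<phi> $$ (1, 1) = - r"
    by (simp_all add: H_gate_index[unfolded One_nat_def] cis cis' r_def)
  have X: "X $$ (0, 0) = \<omega> / 2" "X $$ (0, 1) = - 1 / 2" "X $$ (1, 0) = \<omega> * \<omega> / 2" "X $$ (1, 1) = - \<omega> / 2"
    unfolding x00 x01 x10 x11 t by simp_all
  have "superop_eq 2 F (unitary_superop (H_gate \<phi>))"
  proof (rule superop_eqI[OF SF superoperator_unitary[OF gate_carrier(1)]])
    fix k l a c :: nat assume kl: "k < 2" "l < 2" "a < 2" "c < 2"
    note tab = H[unfolded One_nat_def] X[unfolded One_nat_def] E00[unfolded One_nat_def]
      E11[unfolded One_nat_def] E10[unfolded One_nat_def] X_def[symmetric, unfolded One_nat_def]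
    have "E k l $$ (a, c) = H_gate \<phi> $$ (a, k) * cnj (H_gate \<phi> $$ (c, l))"
      using kl unfolding less_2_cases_iff
      by (elim disjE; simp only:; simp add: tab r rr cancel \<omega>\<omega> mult_ac)
    then show "F (matrix_unit 2 k l) $$ (a, c) = unitary_superop (H_gate \<phi>) (matrix_unit 2 k l) $$ (a, c)"
      unfolding unitary_superop_matrix_unit[OF gate_carrier(1) kl] E_def .
  qed
  with \<phi> show ?thesis by auto
qed

section \<open>The controlled-NOT gates\<close>

text \<open>All real parts are at most \<open>1\<close> and have mean \<open>1\<close>, and the unit
  disc meets the line of real part \<open>1\<close> only in the point \<open>1\<close>.\<close>

lemma sum_eq_card_imp_eq_1:
  fixes f :: "'a \<Rightarrow> complex"
  assumes fin: "finite S" and le: "\<And>i. i \<in> S \<Longrightarrow> cmod (f i) \<le> 1"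
    and sum: "sum f S = of_nat (card S)" and i: "i \<in> S"
  shows "f i = 1"
proof -
  have re: "Re (f j) \<le> 1" if "j \<in> S" for j
    using le[OF that] abs_Re_le_cmod[of "f j"] by linarith
  have "(\<Sum>j\<in>S. 1 - Re (f j)) = 0"
    using arg_cong[OF sum, of Re] by (simp add: sum_subtractf)
  then have "1 - Re (f i) = 0"
    using fin re i by (subst (asm) sum_nonneg_eq_0_iff) auto
  then have "Re (f i) = 1" by simp
  moreover have "(Re (f i))\<^sup>2 + (Im (f i))\<^sup>2 \<le> 1"
    using le[OF i] by (simp add: cmod_power2[symmetric] abs_square_le_1)
  ultimately show ?thesis by (simp add: complex_eq_iff)
qed

text \<open>Cauchy-Schwarz at basis vectors bounds an entry by one diagonal entry of each of the two
  projections, so at most the entry \<open>(p, q)\<close> survives.\<close>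

lemma CPSO_block_index:
  assumes G: "CPSO d G" and ij: "i < d" "j < d"
    and Gi: "G (matrix_unit d i i) = matrix_unit d p p"
    and Gj: "G (matrix_unit d j j) = matrix_unit d q q"
    and ab: "a < d" "b < d"
  shows "cmod (G (matrix_unit d i j) $$ (a, b)) \<le> of_bool (a = p \<and> b = q)"
proof -
  have "(cmod (G (matrix_unit d i j) $$ (a, b)))\<^sup>2 \<le> of_bool (a = p) * of_bool (b = q)"
    using CPSO_cauchy_schwarz[OF G ij, of "\<lambda>k. of_bool (k = a)" "\<lambda>k. of_bool (k = b)"] ab
    unfolding Gi Gj by (simp add: sesq_indicator) (auto simp: matrix_unit_def split: if_splits)
  also have "\<dots> = (of_bool (a = p \<and> b = q))\<^sup>2" by simp
  finally show ?thesis by (rule power2_le_imp_le) simp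
qed

text \<open>In the big-endian numbering \<open>2\<close> and \<open>3\<close> are the basis states
  with control bit one.\<close>

definition cnot_perm :: "nat \<Rightarrow> nat" where
  "cnot_perm i = (if i = 2 then 3 else if i = 3 then 2 else i)"

lemma cnot_perm_less: "i < 4 \<Longrightarrow> cnot_perm i < 4"
  by (auto simp: cnot_perm_def)

lemma cnot_perm_cnot_perm [simp]: "cnot_perm (cnot_perm i) = i"
  by (simp add: cnot_perm_def)

lemma sum_cnot_perm: "(\<Sum>i<4. f (cnot_perm i)) = (\<Sum>i<4. f i)"
  by (simp add: sum_lessThan_4 cnot_perm_def ac_simps)

text \<open>Indexed by the column of the gate: \<open>cis \<phi>\<close> stands in column
  \<open>2\<close> and row \<open>3\<close>.\<close>

definition cnot_phase :: "real \<Rightarrow> nat \<Rightarrow> complex" where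
  "cnot_phase \<phi> i = (if i = 2 then cis \<phi> else if i = 3 then cis (-\<phi>) else 1)"

lemma norm_cnot_phase [simp]: "cmod (cnot_phase \<phi> i) = 1"
  by (simp add: cnot_phase_def)

lemma cNOT_gate_index:
  assumes "a < 4" "i < 4"
  shows "cNOT_gate \<phi> $$ (a, i) = (if a = cnot_perm i then cnot_phase \<phi> i else 0)"
  using assms unfolding less_4_cases_iff
  by (elim disjE; simp only:; simp add: cNOT_gate_def NOT_gate_def mat_of_rows_list_def cnot_perm_def cnot_phase_def)

text \<open>Rewrites the final measurement of the last equation as a form in the state before the
  second pair of gates, taken at the product vector of \<open>h\<close> with itself.\<close>

lemma tensor_superop_index_0:
  assumes F: "\<And>k l. k < 2 \<Longrightarrow> l < 2 \<Longrightarrow> F (matrix_unit 2 k l) \<in> carrier_mat 2 2"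
    and h: "\<And>k l. k < 2 \<Longrightarrow> l < 2 \<Longrightarrow> F (matrix_unit 2 k l) $$ (0, 0) = h k * cnj (h l)"
  shows "tensor_superop 2 2 F F Y $$ (0, 0) =
    (\<Sum>a<4. \<Sum>b<4. (h (a div 2) * h (a mod 2)) * cnj (h (b div 2) * h (b mod 2)) * Y $$ (a, b))"
proof -
  have T: "tensor_mat (F (matrix_unit 2 i j)) (F (matrix_unit 2 k l)) $$ (0, 0) = h i * cnj (h j) * (h k * cnj (h l))"
    if "i < 2" "j < 2" "k < 2" "l < 2" for i j k l
    using F[of i j] F[of k l] h that by (auto simp: tensor_mat_def)
  define g where "g i k j l = (h i * h k) * cnj (h j * h l) * Y $$ (i * 2 + k, j * 2 + l)" for i k j l
  have "tensor_superop 2 2 F F Y $$ (0, 0) = (\<Sum>i<2. \<Sum>j<2. \<Sum>k<2. \<Sum>l<2.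
      Y $$ (i * 2 + k, j * 2 + l) * (h i * cnj (h j) * (h k * cnj (h l))))"
    using T by (simp add: tensor_superop_def)
  \<comment> \<open>Swapping the inner sums brings the two row indices together and the two column
    indices together.\<close>
  also have "\<dots> = (\<Sum>i<2. \<Sum>k<2. \<Sum>j<2. \<Sum>l<2. g i k j l)"
    unfolding g_def by (rule sum.cong[OF refl], subst sum.swap) (simp add: mult_ac)
  also have "\<dots> = (\<Sum>a<2 * 2. \<Sum>b<2 * 2. g (a div 2) (a mod 2) (b div 2) (b mod 2))"
    unfolding sum_div_mod[of "g _ _"] by (rule sum_div_mod[symmetric])
  finally show ?thesis by (simp add: g_def)
qed

lemma tensor_superop_ket_00:
  assumes F: "superoperator 2 F"
    and h: "\<And>k l. k < 2 \<Longrightarrow> l < 2 \<Longrightarrow> F (matrix_unit 2 0 0) $$ (k, l) = h k * cnj (h l)"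
    and ab: "a < 4" "b < 4"
  shows "tensor_superop 2 2 F F (proj (ket [0, 0])) $$ (a, b) =
    (h (a div 2) * h (a mod 2)) * cnj (h (b div 2) * h (b mod 2))"
proof -
  have k: "proj (ket [0, 0]) = tensor_mat (matrix_unit 2 0 0) (matrix_unit 2 0 0)"
    unfolding ket_2 proj_unit_vec
    by (intro eq_matI) (auto simp: tensor_mat_def matrix_unit_def less_4_cases_iff)
  have "F (matrix_unit 2 0 0) \<in> carrier_mat 2 2"
    by (rule superoperator_carrier[OF F matrix_unit_carrier])
  then show ?thesis
    unfolding k tensor_superop_tensor_mat[OF F F matrix_unit_carrier matrix_unit_carrier]
    using ab h[of "a div 2" "b div 2"] h[of "a mod 2" "b mod 2"] by (auto simp: tensor_mat_def)
qed

text \<open>The angle enters only through \<open>F\<close>: the last equation compares the unknown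
  factors of \<open>G\<close> with phases of the product state that \<open>F\<close> prepares, so
  \<open>G\<close> inherits the angle of \<open>F\<close>.\<close>

lemma CPSO_eq_cNOT_gate:
  assumes F: "superop_eq 2 F (unitary_superop (H_gate \<phi>))" "superoperator 2 F"
    and G: "CPSO 4 G"
    and e: "Pr [0, 0] (G (proj (ket [0, 0]))) = 1" "Pr [0, 1] (G (proj (ket [0, 1]))) = 1"
      "Pr [1, 1] (G (proj (ket [1, 0]))) = 1" "Pr [1, 0] (G (proj (ket [1, 1]))) = 1"
    and e12: "Pr [0, 0] ((tensor_superop 2 2 F F \<circ> G \<circ> tensor_superop 2 2 F F) (proj (ket [0, 0]))) = 1"
  shows "superop_eq 4 G (unitary_superop (cNOT_gate \<phi>))"
proof -
  note SG = CPSO_superoperator[OF G]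
  define \<pi> where "\<pi> = cnot_perm"
  define \<mu> where "\<mu> = cnot_phase \<phi>"
  \<comment> \<open>The only entry of the image of a matrix unit that can be nonzero.\<close>
  define c where "c i j = G (matrix_unit 4 i j) $$ (\<pi> i, \<pi> j)" for i j
  have Gc: "G (matrix_unit 4 i j) \<in> carrier_mat 4 4" for i j
    by (rule superoperator_carrier[OF SG matrix_unit_carrier])
  have \<pi>_eq: "\<pi> i = \<pi> j \<longleftrightarrow> i = j" for i j
    by (metis \<pi>_def cnot_perm_cnot_perm)
  have GdI: "G (matrix_unit 4 i i) = matrix_unit 4 j j"
    if "i < 4" "j < 4" "G (matrix_unit 4 i i) $$ (j, j) = 1" for i j
    using that by (intro density_matrix_eq_matrix_unit CPSO_density_matrix[OF G] density_matrix_matrix_unit)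
  have "G (matrix_unit 4 0 0) $$ (0, 0) = 1" "G (matrix_unit 4 1 1) $$ (1, 1) = 1"
    "G (matrix_unit 4 2 2) $$ (3, 3) = 1" "G (matrix_unit 4 3 3) $$ (2, 2) = 1"
    using e Pr_eq_diag[OF ket_2(1) _ Gc] Pr_eq_diag[OF ket_2(2) _ Gc]
      Pr_eq_diag[OF ket_2(3) _ Gc] Pr_eq_diag[OF ket_2(4) _ Gc]
    unfolding ket_2 proj_unit_vec by simp_all
  then have Gd: "G (matrix_unit 4 i i) = matrix_unit 4 (\<pi> i) (\<pi> i)" if "i < 4" for i
    using that unfolding less_4_cases_iff \<pi>_def
    by (elim disjE; simp only:) (rule GdI; simp add: cnot_perm_def)+
  have Gle: "cmod (G (matrix_unit 4 i j) $$ (a, b)) \<le> of_bool (a = \<pi> i \<and> b = \<pi> j)"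
    if "i < 4" "j < 4" "a < 4" "b < 4" for i j a b
    using CPSO_block_index[OF G that(1,2) Gd Gd that(3,4)] that by simp
  have Ge: "G (matrix_unit 4 i j) $$ (a, b) = (if a = \<pi> i \<and> b = \<pi> j then c i j else 0)"
    if "i < 4" "j < 4" "a < 4" "b < 4" for i j a b
    using Gle[OF that] by (auto simp: c_def)
  have c1: "cmod (c i j) \<le> 1" if "i < 4" "j < 4" for i j
    using Gle[OF that, of "\<pi> i" "\<pi> j"] that by (simp add: c_def \<pi>_def cnot_perm_less)
  have Fe: "F (matrix_unit 2 k l) = unitary_superop (H_gate \<phi>) (matrix_unit 2 k l)" for k l
    using F(1) by (simp add: superop_eq_def)
  \<comment> \<open>\<open>h\<close> holds the amplitudes of the gate applied to the first basis
    state, and \<open>v\<close> those of two such qubits.\<close>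
  define h where "h k = (if k = 0 then 1 / sqrt 2 else cis \<phi> / sqrt 2)" for k :: nat
  define v where "v a = h (a div 2) * h (a mod 2)" for a
  have F0: "F (matrix_unit 2 0 0) $$ (k, l) = h k * cnj (h l)" if "k < 2" "l < 2" for k l
    unfolding Fe unitary_superop_matrix_unit[OF gate_carrier(1) pos2 pos2 that] using that
    by (auto simp: less_2_cases_iff H_gate_index[unfolded One_nat_def] h_def)
  have F00: "F (matrix_unit 2 k l) $$ (0, 0) = cnj (h k) * cnj (cnj (h l))" if "k < 2" "l < 2" for k l
    unfolding Fe unitary_superop_matrix_unit[OF gate_carrier(1) that pos2 pos2] using that
    by (auto simp: less_2_cases_iff H_gate_index[unfolded One_nat_def] h_def cis_cnj)
  define \<sigma> where "\<sigma> = tensor_superop 2 2 F F (proj (ket [0, 0]))"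
  have \<sigma>c: "\<sigma> \<in> carrier_mat 4 4" by (simp add: \<sigma>_def tensor_superop_def)
  have \<sigma>: "\<sigma> $$ (a, b) = v a * cnj (v b)" if "a < 4" "b < 4" for a b
    unfolding \<sigma>_def v_def using tensor_superop_ket_00[OF F(2) F0 that] by simp
  have G\<sigma>: "G \<sigma> $$ (\<pi> i, \<pi> j) = v i * cnj (v j) * c i j" if ij: "i < 4" "j < 4" for i j
  proof -
    have pp: "\<pi> i < 4" "\<pi> j < 4" using ij by (simp_all add: \<pi>_def cnot_perm_less)
    have "G \<sigma> $$ (\<pi> i, \<pi> j) = (\<Sum>k<4. \<Sum>l<4. if k = i then if l = j then v k * cnj (v l) * c k l else 0 else 0)"
      unfolding superoperator_expand[OF SG \<sigma>c pp]
      by (intro sum.cong refl) (auto simp: \<sigma> Ge[OF _ _ pp] \<pi>_eq)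
    then show ?thesis using ij by (simp add: sum_delta_2)
  qed
  \<comment> \<open>All amplitudes in \<open>v\<close> have modulus \<open>1 / 2\<close>, and the
    two states exchanged by \<open>\<pi>\<close> differ in phase by exactly
    \<open>\<phi>\<close>.\<close>
  have v\<mu>: "4 * (v i * cnj (v (\<pi> i))) = cnj (\<mu> i)" if "i < 4" for i
  proof -
    have "cis \<phi> * cis (-\<phi>) = 1" by (simp add: cis_mult)
    moreover have "complex_of_real (sqrt 2) * complex_of_real (sqrt 2) = 2"
      by (metis of_real_mult of_real_numeral real_sqrt_mult_self abs_numeral)
    ultimately show ?thesis
      using that unfolding less_4_cases_iff
      by (elim disjE; simp only:; simp add: v_def h_def \<pi>_def \<mu>_def cnot_perm_def cnot_phase_def cis_cnj field_simps)
  qed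
  have "1 = tensor_superop 2 2 F F (G \<sigma>) $$ (0, 0)"
  proof -
    have "tensor_superop 2 2 F F (G \<sigma>) \<in> carrier_mat 4 4" by (simp add: tensor_superop_def)
    from Pr_eq_diag[OF ket_2(1) _ this] show ?thesis using e12 by (simp add: \<sigma>_def)
  qed
  also have "\<dots> = (\<Sum>a<4. \<Sum>b<4. cnj (v a) * v b * G \<sigma> $$ (a, b))"
    using tensor_superop_index_0[where h = "\<lambda>k. cnj (h k)", OF superoperator_carrier[OF F(2) matrix_unit_carrier] F00]
    by (simp add: v_def)
  \<comment> \<open>Both sums are reindexed by \<open>\<pi>\<close>, so that each entry of
    \<open>G \<sigma>\<close> becomes a single term.\<close>
  also have "\<dots> = (\<Sum>i<4. \<Sum>j<4. cnj (v (\<pi> i)) * v (\<pi> j) * G \<sigma> $$ (\<pi> i, \<pi> j))"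
    unfolding \<pi>_def
    using sum_cnot_perm[of "\<lambda>a. \<Sum>j<4. cnj (v a) * v (cnot_perm j) * G \<sigma> $$ (a, cnot_perm j)"]
      sum_cnot_perm[of "\<lambda>b. cnj (v a) * v b * G \<sigma> $$ (a, b)" for a]
    by simp
  \<comment> \<open>Each term contains four amplitudes of modulus \<open>1 / 2\<close>; the factor
    \<open>16\<close> leaves pure phases times \<open>c i j\<close>.\<close>
  also have "16 * \<dots> = (\<Sum>i<4. \<Sum>j<4. cnj (\<mu> i) * \<mu> j * c i j)"
    unfolding sum_distrib_left
  proof (intro sum.cong refl)
    fix i j :: nat assume ij: "i \<in> {..<4}" "j \<in> {..<4}"
    have "16 * (cnj (v (\<pi> i)) * v (\<pi> j) * G \<sigma> $$ (\<pi> i, \<pi> j)) =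
       (4 * (v i * cnj (v (\<pi> i)))) * cnj (4 * (v j * cnj (v (\<pi> j)))) * c i j"
      using ij by (simp add: G\<sigma>)
    also have "\<dots> = cnj (\<mu> i) * \<mu> j * c i j"
      using ij by (simp only: v\<mu> lessThan_iff complex_cnj_cnj)
    finally show "16 * (cnj (v (\<pi> i)) * v (\<pi> j) * G \<sigma> $$ (\<pi> i, \<pi> j)) = cnj (\<mu> i) * \<mu> j * c i j" .
  qed
  finally have "(\<Sum>(i, j) \<in> {..<4} \<times> {..<4}. cnj (\<mu> i) * \<mu> j * c i j) = of_nat (card ({..<4::nat} \<times> {..<4::nat}))"
    by (simp add: sum.cartesian_product)
  \<comment> \<open>Sixteen numbers in the unit disc have sum \<open>16\<close>.\<close>
  then have "(case (i, j) of (i, j) \<Rightarrow> cnj (\<mu> i) * \<mu> j * c i j) = 1" if "i < 4" "j < 4" for i j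
    by (rule sum_eq_card_imp_eq_1[rotated 2]) (use that c1 in \<open>auto simp: norm_mult \<mu>_def\<close>)
  then have m: "cnj (\<mu> i) * \<mu> j * c i j = 1" if "i < 4" "j < 4" for i j using that by simp
  have c: "c i j = \<mu> i * cnj (\<mu> j)" if "i < 4" "j < 4" for i j
  proof -
    have "\<mu> k * cnj (\<mu> k) = 1" for k
      by (simp add: \<mu>_def complex_norm_square[symmetric])
    then have "c i j = \<mu> i * cnj (\<mu> j) * (cnj (\<mu> i) * \<mu> j * c i j)"
      by (metis (no_types, lifting) mult.assoc mult.commute mult_1)
    then show ?thesis using m[OF that] by simp
  qed
  show ?thesis
  proof (rule superop_eqI[OF SG superoperator_unitary[OF gate_carrier(3)]])
    fix k l a b :: nat assume kl: "k < 4" "l < 4" "a < 4" "b < 4"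
    show "G (matrix_unit 4 k l) $$ (a, b) = unitary_superop (cNOT_gate \<phi>) (matrix_unit 4 k l) $$ (a, b)"
      unfolding unitary_superop_matrix_unit[OF gate_carrier(3) kl] Ge[OF kl]
      using kl c by (simp add: cNOT_gate_index \<pi>_def \<mu>_def)
  qed
qed

section \<open>The gates satisfy the equations\<close>

lemma unitary_superop_proj:
  assumes A: "A \<in> carrier_mat d d" and v: "v \<in> carrier_vec d"
  shows "unitary_superop A (proj v) = proj (A *\<^sub>v v)"
proof (rule eq_matI)
  have P: "proj v \<in> carrier_mat d d" using v by (simp add: proj_def)
  fix a b assume "a < dim_row (proj (A *\<^sub>v v))" "b < dim_col (proj (A *\<^sub>v v))"
  then have ab: "a < d" "b < d" using A by (auto simp: proj_def)
  have "unitary_superop A (proj v) $$ (a, b) = (\<Sum>k<d. \<Sum>l<d. (A $$ (a, k) * v $ k) * cnj (A $$ (b, l) * v $ l))"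
    unfolding unitary_superop_index[OF A P ab] using v
    by (intro sum.cong refl) (auto simp: proj_def)
  also have "\<dots> = proj (A *\<^sub>v v) $$ (a, b)"
    using A v ab by (simp add: proj_def scalar_prod_def atLeast0LessThan sum_product)
  finally show "unitary_superop A (proj v) $$ (a, b) = proj (A *\<^sub>v v) $$ (a, b)" .
qed (use A v in \<open>auto simp: proj_def unitary_superop_def\<close>)

lemma proj_tensor_vec: "proj (tensor_vec u v) = tensor_mat (proj u) (proj v)"
proof (rule eq_matI)
  fix i j assume "i < dim_row (tensor_mat (proj u) (proj v))" "j < dim_col (tensor_mat (proj u) (proj v))"
  then have ij: "i < dim_vec u * dim_vec v" "j < dim_vec u * dim_vec v"
    by (simp_all add: tensor_mat_def proj_def)
  then have "0 < dim_vec v" by (cases "dim_vec v") auto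
  then show "proj (tensor_vec u v) $$ (i, j) = tensor_mat (proj u) (proj v) $$ (i, j)"
    using ij by (simp add: proj_def tensor_vec_def tensor_mat_def less_mult_imp_div_less)
qed (simp_all add: proj_def tensor_vec_def tensor_mat_def)

text \<open>Keeps the verification on pure product states, where each factor is followed
  separately.\<close>

lemma tensor_superop_proj:
  assumes "superoperator m F" "superoperator n G" "u \<in> carrier_vec m" "v \<in> carrier_vec n"
    and "F (proj u) = proj u'" "G (proj v) = proj v'"
  shows "tensor_superop m n F G (proj (tensor_vec u v)) = proj (tensor_vec u' v')"
proof -
  have "proj u \<in> carrier_mat m m" "proj v \<in> carrier_mat n n"
    using assms(3,4) by (simp_all add: proj_def)
  then show ?thesis
    using assms by (simp add: proj_tensor_vec tensor_superop_tensor_mat)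
qed

lemma superoperator_id: "superoperator d id"
  by (simp add: superoperator_def)

lemma H_gate_involution:
  assumes v: "v \<in> carrier_vec 2"
  shows "H_gate \<phi> *\<^sub>v (H_gate \<phi> *\<^sub>v v) = v"
proof -
  have c: "cis \<phi> * cis (-\<phi>) = 1" by (simp add: cis_mult)
  have s: "complex_of_real (sqrt 2) * complex_of_real (sqrt 2) = 2"
    by (metis of_real_mult of_real_numeral real_sqrt_mult_self abs_numeral)
  have "H_gate \<phi> *\<^sub>v v \<in> carrier_vec 2" by (rule mult_mat_vec_carrier[OF gate_carrier(1) v])
  from mult_vec_2[OF gate_carrier(1) this] show ?thesis
    using v c s unfolding mult_vec_2[OF gate_carrier(1) v]
    by (intro eq_vecI) (auto simp: less_2_cases_iff H_gate_index[unfolded One_nat_def] field_simps)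
qed

text \<open>With amplitudes proportional to \<open>1\<close> and \<open>cis \<phi>\<close>, the
  phases of the NOT gate just exchange the two terms.\<close>

lemma NOT_gate_H_gate:
  "NOT_gate \<phi> *\<^sub>v (H_gate \<phi> *\<^sub>v unit_vec 2 0) = H_gate \<phi> *\<^sub>v unit_vec 2 0"
proof -
  have c: "cis (-\<phi>) * cis \<phi> = 1" by (simp add: cis_mult)
  have "H_gate \<phi> *\<^sub>v unit_vec 2 0 \<in> carrier_vec 2"
    by (rule mult_mat_vec_carrier[OF gate_carrier(1) unit_vec_carrier])
  from mult_vec_2[OF gate_carrier(2) this] show ?thesis
    using c unfolding mult_vec_2[OF gate_carrier(1) unit_vec_carrier]
    by (intro eq_vecI) (auto simp: less_2_cases_iff H_gate_index[unfolded One_nat_def] NOT_gate_def mat_of_rows_list_def)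
qed

lemma cNOT_gate_dim [simp]: "dim_row (cNOT_gate \<phi>) = 4" "dim_col (cNOT_gate \<phi>) = 4"
  using carrier_matD[OF gate_carrier(3)] by auto

lemma cNOT_gate_mult_vec_index:
  assumes i: "i < 4" and x: "x \<in> carrier_vec 4"
  shows "(cNOT_gate \<phi> *\<^sub>v x) $ i = cnot_phase \<phi> (cnot_perm i) * x $ cnot_perm i"
proof -
  have p: "i = cnot_perm j \<longleftrightarrow> j = cnot_perm i" for j
    by (metis cnot_perm_cnot_perm)
  have "(cNOT_gate \<phi> *\<^sub>v x) $ i = (\<Sum>j<4. cNOT_gate \<phi> $$ (i, j) * x $ j)"
    using i x by (simp add: scalar_prod_def atLeast0LessThan)
  also have "\<dots> = (\<Sum>j<4. if j = cnot_perm i then cnot_phase \<phi> j * x $ j else 0)"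
    using i by (intro sum.cong refl) (simp add: cNOT_gate_index p)
  finally show ?thesis using i by (simp add: cnot_perm_less)
qed

text \<open>If the NOT gate fixes the target, the control value makes no difference.\<close>

lemma cNOT_gate_tensor_fixed:
  assumes u: "u \<in> carrier_vec 2" and v: "v \<in> carrier_vec 2" and N: "NOT_gate \<phi> *\<^sub>v v = v"
  shows "cNOT_gate \<phi> *\<^sub>v tensor_vec u v = tensor_vec u v"
proof (rule eq_vecI)
  have "(NOT_gate \<phi> *\<^sub>v v) $ 0 = cis (-\<phi>) * v $ 1" "(NOT_gate \<phi> *\<^sub>v v) $ 1 = cis \<phi> * v $ 0"
    unfolding mult_vec_2[OF gate_carrier(2) v] by (simp_all add: NOT_gate_def mat_of_rows_list_def)
  then have v01: "cis (-\<phi>) * v $ 1 = v $ 0" "cis \<phi> * v $ 0 = v $ 1" unfolding N by simp_all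
  have c: "tensor_vec u v \<in> carrier_vec 4"
    using u v by (intro carrier_vecI) (auto simp: tensor_vec_def)
  fix i assume "i < dim_vec (tensor_vec u v)"
  then have i: "i < 4" using c by auto
  then show "(cNOT_gate \<phi> *\<^sub>v tensor_vec u v) $ i = tensor_vec u v $ i"
    unfolding cNOT_gate_mult_vec_index[OF i c] using u v v01 unfolding less_4_cases_iff
    by (elim disjE; simp only:; simp add: tensor_vec_def cnot_perm_def cnot_phase_def mult.left_commute)
qed (use u v in \<open>simp add: tensor_vec_def\<close>)

text \<open>A state in the exchanged pair collects both \<open>cis \<phi>\<close> and
  \<open>cis (-\<phi>)\<close>, which cancel.\<close>

lemma cNOT_gate_involution:
  assumes w: "w \<in> carrier_vec 4"
  shows "cNOT_gate \<phi> *\<^sub>v (cNOT_gate \<phi> *\<^sub>v w) = w"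
proof -
  have "cis \<phi> * cis (-\<phi>) = 1" "cis (-\<phi>) * cis \<phi> = 1" by (simp_all add: cis_mult)
  then have ph: "cnot_phase \<phi> (cnot_perm i) * (cnot_phase \<phi> i * z) = z" for i z
    by (auto simp: cnot_phase_def cnot_perm_def simp flip: mult.assoc)
  have c: "cNOT_gate \<phi> *\<^sub>v w \<in> carrier_vec 4"
    using gate_carrier(3) w by (rule mult_mat_vec_carrier)
  show ?thesis
  proof (rule eq_vecI)
    fix i assume "i < dim_vec w"
    then have i: "i < 4" using w by simp
    show "(cNOT_gate \<phi> *\<^sub>v (cNOT_gate \<phi> *\<^sub>v w)) $ i = w $ i"
      unfolding cNOT_gate_mult_vec_index[OF i c] cNOT_gate_mult_vec_index[OF cnot_perm_less[OF i] w]
      using ph[of i] by simp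
  qed (use w in simp)
qed

lemma Pr_proj:
  assumes "ket w = unit_vec d i" "i < d" "v \<in> carrier_vec d"
  shows "Pr w (proj v) = v $ i * cnj (v $ i)"
  using assms Pr_eq_diag[OF assms(1,2), of "proj v"] by (simp add: proj_def)

text \<open>With \<open>h\<close> the Hadamard image of \<open>e 0\<close>, \<open>F\<close>
  exchanges the states of \<open>e 0\<close> and \<open>h\<close>, \<open>G\<close> fixes product
  states with target \<open>h\<close>, and \<open>G\<close> applied twice fixes every pure state.
  The composed equations on two qubits follow by tracing product vectors.\<close>

lemma gates_satisfy_equations:
  assumes F: "superoperator 2 F" "superop_eq 2 F (unitary_superop (H_gate \<phi>))"
    and G: "superop_eq 4 G (unitary_superop (cNOT_gate \<phi>))"
  shows "Pr [0] (F (proj (ket [0]))) = 1 / 2"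
    and "Pr [0] ((F \<circ> F) (proj (ket [0]))) = 1"
    and "Pr [0] ((F \<circ> F) (proj (ket [1]))) = 0"
    and "Pr [0, 0] (G (proj (ket [0, 0]))) = 1"
    and "Pr [0, 1] (G (proj (ket [0, 1]))) = 1"
    and "Pr [1, 1] (G (proj (ket [1, 0]))) = 1"
    and "Pr [1, 0] (G (proj (ket [1, 1]))) = 1"
    and "Pr [0, 0] ((tensor_superop 2 2 id F \<circ> G \<circ> tensor_superop 2 2 id F) (proj (ket [0, 0]))) = 1"
    and "Pr [1, 0] ((tensor_superop 2 2 id F \<circ> G \<circ> tensor_superop 2 2 id F) (proj (ket [1, 0]))) = 1"
    and "Pr [0, 0] ((tensor_superop 2 2 F id \<circ> (G \<circ> G) \<circ> tensor_superop 2 2 F id) (proj (ket [0, 0]))) = 1"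
    and "Pr [0, 1] ((tensor_superop 2 2 F id \<circ> (G \<circ> G) \<circ> tensor_superop 2 2 F id) (proj (ket [0, 1]))) = 1"
    and "Pr [0, 0] ((tensor_superop 2 2 F F \<circ> G \<circ> tensor_superop 2 2 F F) (proj (ket [0, 0]))) = 1"
proof -
  have Fp: "F (proj v) = proj (H_gate \<phi> *\<^sub>v v)" if "v \<in> carrier_vec 2" for v
    using F(2) that unitary_superop_proj[OF gate_carrier(1) that]
    by (simp add: superop_eq_def proj_def)
  have Gp: "G (proj w) = proj (cNOT_gate \<phi> *\<^sub>v w)" if "w \<in> carrier_vec 4" for w
    using G that unitary_superop_proj[OF gate_carrier(3) that]
    by (simp add: superop_eq_def proj_def)
  define e where "e b = (unit_vec 2 b :: complex vec)" for b
  define h where "h = H_gate \<phi> *\<^sub>v e 0"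
  have ec: "e b \<in> carrier_vec 2" for b by (simp add: e_def)
  have hc: "h \<in> carrier_vec 2"
    unfolding h_def by (rule mult_mat_vec_carrier[OF gate_carrier(1) ec])
  have Nh: "NOT_gate \<phi> *\<^sub>v h = h" unfolding h_def e_def by (rule NOT_gate_H_gate)
  have Hh: "H_gate \<phi> *\<^sub>v h = e 0" unfolding h_def by (rule H_gate_involution[OF ec])
  have Fe: "F (proj (e 0)) = proj h" and Fh: "F (proj h) = proj (e 0)"
    using Fp[OF ec] Fp[OF hc] Hh by (simp_all add: h_def)
  have FF: "F (F (proj (e b))) = proj (e b)" for b
    using Fp[OF ec] Fp[OF mult_mat_vec_carrier[OF gate_carrier(1) ec]] H_gate_involution[OF ec] by simp
  have k: "ket [a, b] = tensor_vec (e a) (e b)" for a b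
    using ket.simps(2)[of a "[b]"] unfolding ket_1 e_def .
  have tc: "tensor_vec u v \<in> carrier_vec 4" if "u \<in> carrier_vec 2" "v \<in> carrier_vec 2" for u v
    using that by (intro carrier_vecI) (auto simp: tensor_vec_def)
  have Gh: "G (proj (tensor_vec u h)) = proj (tensor_vec u h)" if "u \<in> carrier_vec 2" for u
    using Gp[OF tc[OF that hc]] cNOT_gate_tensor_fixed[OF that hc Nh] by simp
  have GG: "G (G (proj w)) = proj w" if "w \<in> carrier_vec 4" for w
    using Gp[OF that] Gp[OF mult_mat_vec_carrier[OF gate_carrier(3) that]] cNOT_gate_involution[OF that] by simp
  have P2: "Pr [0] (proj (e b)) = of_bool (b = 0)" if "b < 2" for b
    using Pr_proj[OF ket_1[of 0] pos2 ec] that by (simp add: e_def)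
  have P4: "Pr [a, b] (proj (ket [a, b])) = 1" if "a < 2" "b < 2" for a b
    using that unfolding less_2_cases_iff One_nat_def[symmetric]
    by (elim disjE; simp only: ket_2 Pr_proj[OF ket_2(1) _ unit_vec_carrier] Pr_proj[OF ket_2(2) _ unit_vec_carrier]
       Pr_proj[OF ket_2(3) _ unit_vec_carrier] Pr_proj[OF ket_2(4) _ unit_vec_carrier]; simp)
  note tp = tensor_superop_proj[OF superoperator_id F(1)] tensor_superop_proj[OF F(1) superoperator_id]
    tensor_superop_proj[OF F(1) F(1)]
  show "Pr [0] (F (proj (ket [0]))) = 1 / 2"
  proof -
    have "h $ 0 = 1 / sqrt 2"
      unfolding h_def mult_vec_2[OF gate_carrier(1) ec] by (simp add: e_def H_gate_index)
    moreover have "complex_of_real (sqrt 2) * complex_of_real (sqrt 2) = 2"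
      by (metis of_real_mult of_real_numeral real_sqrt_mult_self abs_numeral)
    ultimately show ?thesis
      using Fe Pr_proj[OF ket_1[of 0] pos2 hc] unfolding ket_1 e_def by simp
  qed
  show "Pr [0] ((F \<circ> F) (proj (ket [0]))) = 1" "Pr [0] ((F \<circ> F) (proj (ket [1]))) = 0"
    using FF[of 0] FF[of 1] P2[of 0] P2[of 1] unfolding ket_1 e_def comp_def by simp_all
  \<comment> \<open>A basis state is sent to the corresponding column of the gate, whose single
    nonzero entry has modulus one.\<close>
  have Ge: "G (proj (ket [a, b])) = proj (vec 4 (\<lambda>i. cNOT_gate \<phi> $$ (i, 2 * a + b)))" if "a < 2" "b < 2" for a b
  proof -
    have u: "ket [a, b] = unit_vec 4 (2 * a + b)"
      using that ket_2 unfolding less_2_cases_iff by auto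
    have "cNOT_gate \<phi> *\<^sub>v unit_vec 4 (2 * a + b) = vec 4 (\<lambda>i. cNOT_gate \<phi> $$ (i, 2 * a + b))"
      using that by (intro eq_vecI) auto
    then show ?thesis using Gp[of "unit_vec 4 (2 * a + b)"] u by simp
  qed
  have cc: "cis \<phi> * cnj (cis \<phi>) = 1" "cis (-\<phi>) * cnj (cis (-\<phi>)) = 1"
    by (simp_all add: cis_cnj cis_mult)
  show "Pr [0, 0] (G (proj (ket [0, 0]))) = 1" "Pr [0, 1] (G (proj (ket [0, 1]))) = 1"
    "Pr [1, 1] (G (proj (ket [1, 0]))) = 1" "Pr [1, 0] (G (proj (ket [1, 1]))) = 1"
    using Ge[OF pos2 pos2] Ge[OF pos2 one_less_2] Ge[OF one_less_2 pos2] Ge[OF one_less_2 one_less_2]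
      Pr_proj[OF ket_2(1) _ vec_carrier] Pr_proj[OF ket_2(2) _ vec_carrier]
      Pr_proj[OF ket_2(3) _ vec_carrier] Pr_proj[OF ket_2(4) _ vec_carrier] cc
    by (simp_all add: cNOT_gate_index cnot_perm_def cnot_phase_def del: ket.simps One_nat_def)
  have a: "tensor_superop 2 2 id F (proj (tensor_vec (e b) (e 0))) = proj (tensor_vec (e b) h)"
    "tensor_superop 2 2 id F (proj (tensor_vec (e b) h)) = proj (tensor_vec (e b) (e 0))" for b
    by (rule tp; simp add: ec hc Fe Fh)+
  show "Pr [0, 0] ((tensor_superop 2 2 id F \<circ> G \<circ> tensor_superop 2 2 id F) (proj (ket [0, 0]))) = 1"
    "Pr [1, 0] ((tensor_superop 2 2 id F \<circ> G \<circ> tensor_superop 2 2 id F) (proj (ket [1, 0]))) = 1"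
    using P4[OF pos2 pos2] P4[OF one_less_2 pos2] unfolding k comp_def a Gh[OF ec] .
  have b: "tensor_superop 2 2 F id (proj (tensor_vec (e 0) (e b))) = proj (tensor_vec h (e b))"
    "tensor_superop 2 2 F id (proj (tensor_vec h (e b))) = proj (tensor_vec (e 0) (e b))" for b
    by (rule tp; simp add: ec hc Fe Fh)+
  show "Pr [0, 0] ((tensor_superop 2 2 F id \<circ> (G \<circ> G) \<circ> tensor_superop 2 2 F id) (proj (ket [0, 0]))) = 1"
    "Pr [0, 1] ((tensor_superop 2 2 F id \<circ> (G \<circ> G) \<circ> tensor_superop 2 2 F id) (proj (ket [0, 1]))) = 1"
    using P4[OF pos2 pos2] P4[OF pos2 one_less_2] unfolding k comp_def b GG[OF tc[OF hc ec]] .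
  have c: "tensor_superop 2 2 F F (proj (tensor_vec (e 0) (e 0))) = proj (tensor_vec h h)"
    "tensor_superop 2 2 F F (proj (tensor_vec h h)) = proj (tensor_vec (e 0) (e 0))"
    by (rule tp; simp add: ec hc Fe Fh)+
  show "Pr [0, 0] ((tensor_superop 2 2 F F \<circ> G \<circ> tensor_superop 2 2 F F) (proj (ket [0, 0]))) = 1"
    using P4[OF pos2 pos2] unfolding k comp_def c Gh[OF hc] .
qed

theorem theorem3:
  fixes F G :: "complex mat \<Rightarrow> complex mat"
  assumes "CPSO 2 F" and "CPSO 4 G"
  shows "(\<exists>\<phi> \<in> {0..<2 * pi}.
      superop_eq 2 F (unitary_superop (H_gate \<phi>)) \<and>
      superop_eq 4 G (unitary_superop (cNOT_gate \<phi>)))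
    \<longleftrightarrow>
      Pr [0] (F (proj (ket [0]))) = 1 / 2 \<and>
      Pr [0] ((F \<circ> F) (proj (ket [0]))) = 1 \<and>
      Pr [0] ((F \<circ> F) (proj (ket [1]))) = 0 \<and>
      Pr [0, 0] (G (proj (ket [0, 0]))) = 1 \<and>
      Pr [0, 1] (G (proj (ket [0, 1]))) = 1 \<and>
      Pr [1, 1] (G (proj (ket [1, 0]))) = 1 \<and>
      Pr [1, 0] (G (proj (ket [1, 1]))) = 1 \<and>
      Pr [0, 0] ((tensor_superop 2 2 id F \<circ> G \<circ> tensor_superop 2 2 id F) (proj (ket [0, 0]))) = 1 \<and>
      Pr [1, 0] ((tensor_superop 2 2 id F \<circ> G \<circ> tensor_superop 2 2 id F) (proj (ket [1, 0]))) = 1 \<and>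
      Pr [0, 0] ((tensor_superop 2 2 F id \<circ> (G \<circ> G) \<circ> tensor_superop 2 2 F id) (proj (ket [0, 0]))) = 1 \<and>
      Pr [0, 1] ((tensor_superop 2 2 F id \<circ> (G \<circ> G) \<circ> tensor_superop 2 2 F id) (proj (ket [0, 1]))) = 1 \<and>
      Pr [0, 0] ((tensor_superop 2 2 F F \<circ> G \<circ> tensor_superop 2 2 F F) (proj (ket [0, 0]))) = 1"
    (is "?gates \<longleftrightarrow> ?equations")
proof
  note SF = CPSO_superoperator[OF assms(1)]
  show ?equations if ?gates
    using that by (elim bexE conjE, intro conjI) (rule gates_satisfy_equations[OF SF]; assumption)+
  show ?gates if e: ?equations
  proof -
    \<comment> \<open>The equations on \<open>F\<close> alone supply the angle, which is then passed
      on to \<open>G\<close>.\<close>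
    from e obtain \<phi> where \<phi>: "\<phi> \<in> {0..<2 * pi}" "superop_eq 2 F (unitary_superop (H_gate \<phi>))"
      using CPSO_eq_H_gate[OF assms(1)] by blast
    moreover have "superop_eq 4 G (unitary_superop (cNOT_gate \<phi>))"
      by (rule CPSO_eq_cNOT_gate[OF \<phi>(2) SF assms(2)]) (use e in blast)+
    ultimately show ?thesis by blast
  qed
qed

end
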